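(* (a) The subspace $\{S_{A}^{A_2},S_{A}^{A_2}\}$ is an ideal of the associative algebra $S_{A}^{A_2}$: it is the augmentation ideal of $S_{A}^{A_2}$. (b) The subspace $\{S_{B}^{B_2},S_{B}^{B_2}\}$ is not an ideal of the associative algebra $S_{B}^{B_2}$. (c) The subspace $\{S_{A}^{G_2},S_{A}^{G_2}\}$ is not an ideal of the associative algebra $S_{A}^{G_2}$.
   Context: For a Poisson algebra $P$, $\{P,P\}$ denotes the linear span of all brackets. Type $B_2$: $S_B=\mathbb{C}[x_1,x_2,y_1,y_2]$ with Poisson bracket $\{x_i,y_j\}=\delta_{ij}$, $\{x_i,x_j\}=\{y_i,y_j\}=0$; the group $B_2=\{\pm1\}^2\rtimes S_2$ acts by signed permutations of the indices, simultaneously on the $x_i$ and the $y_i$ (the same signs for $x_i$ and $y_i$). Types $A_2$, $G_2$: $\mathbb{C}[x_1,x_2,x_3,y_1,y_2,y_3]$ has Poisson bracket $\{x_i,y_j\}=\delta_{ij}$, $\{x_i,x_j\}=\{y_i,y_j\}=0$, and $A_2=S_3$ acts on it by simultaneous permutation of the indices; $S_A$ is the subalgebra generated by $x_1-x_2$, $x_1-x_3$, $y_1-y_2$, $y_1-y_3$, which is a Poisson subalgebra stable under $A_2$. The group $G_2=A_2\times\{\pm\mathrm{Id}\}$ acts on $S_A$, with $-\mathrm{Id}$ acting by $-1$ on each of these four generators. Superscripts denote algebras of invariants (which are Poisson subalgebras, graded by polynomial degree), and the augmentation ideal is the ideal of invariants with zero constant term. *)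

theory Defs
  imports
    Complex_Main
    "HOL-Library.Poly_Mapping"
    "HOL-Library.Numeral_Type"
    "HOL-Algebra.Ideal"
begin

section \<open>Polynomials in the variables \<open>x\<^sub>i\<close>, \<open>y\<^sub>i\<close>\<close>

datatype 'i var = X 'i | Y 'i

text \<open>
  The index type will be \<^typ>\<open>2\<close> or \<^typ>\<open>3\<close> from \<^theory>\<open>HOL-Library.Numeral_Type\<close>, whose
  elements are \<open>1, 2\<close> and \<open>1, 2, 3\<close>, respectively (with \<open>2 = 0\<close> in \<^typ>\<open>2\<close> and \<open>3 = 0\<close> in \<^typ>\<open>3\<close>).
  A polynomial maps each monomial, i.e. each vector of exponents, to its coefficient; the ring
  structure is the convolution ring structure of \<^theory>\<open>HOL-Library.Poly_Mapping\<close>.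
\<close>

type_synonym 'i pol = "('i var \<Rightarrow>\<^sub>0 nat) \<Rightarrow>\<^sub>0 complex"

definition Const :: "complex \<Rightarrow> 'i pol" where
  "Const c = Poly_Mapping.single 0 c"

definition Var :: "'i var \<Rightarrow> 'i pol" where
  "Var v = Poly_Mapping.single (Poly_Mapping.single v 1) 1"

definition scale :: "complex \<Rightarrow> 'i pol \<Rightarrow> 'i pol" where
  "scale c f = Const c * f"

definition pdiff :: "'i var \<Rightarrow> 'i pol \<Rightarrow> 'i pol" where
  "pdiff v f = (\<Sum>m\<in>Poly_Mapping.keys f.
     Poly_Mapping.single (m - Poly_Mapping.single v 1)
       (of_nat (Poly_Mapping.lookup m v) * Poly_Mapping.lookup f m))"

definition subst :: "('i var \<Rightarrow> 'i pol) \<Rightarrow> 'i pol \<Rightarrow> 'i pol" where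
  "subst \<sigma> f = (\<Sum>m\<in>Poly_Mapping.keys f.
     Const (Poly_Mapping.lookup f m) *
     (\<Prod>v\<in>Poly_Mapping.keys m. \<sigma> v ^ Poly_Mapping.lookup m v))"

definition poisson :: "'i::finite pol \<Rightarrow> 'i pol \<Rightarrow> 'i pol" where
  "poisson f g =
     (\<Sum>i\<in>UNIV. pdiff (X i) f * pdiff (Y i) g - pdiff (Y i) f * pdiff (X i) g)"

definition bracket_span :: "'i::finite pol set \<Rightarrow> 'i pol set" where
  "bracket_span P = module.span scale {poisson f g | f g. f \<in> P \<and> g \<in> P}"

inductive_set subalgebra :: "'i pol set \<Rightarrow> 'i pol set" for G where
  gen: "g \<in> G \<Longrightarrow> g \<in> subalgebra G"
| const: "Const c \<in> subalgebra G"
| add: "f \<in> subalgebra G \<Longrightarrow> g \<in> subalgebra G \<Longrightarrow> f + g \<in> subalgebra G"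
| mult: "f \<in> subalgebra G \<Longrightarrow> g \<in> subalgebra G \<Longrightarrow> f * g \<in> subalgebra G"

definition alg :: "'i pol set \<Rightarrow> 'i pol ring" where
  "alg P = \<lparr>carrier = P, monoid.mult = (*), one = 1, ring.zero = 0, add = (+)\<rparr>"

definition augmentation_ideal :: "'i pol set \<Rightarrow> 'i pol set" where
  "augmentation_ideal P = {f \<in> P. Poly_Mapping.lookup f 0 = 0}"

section \<open>Signed permutations and invariants\<close>

text \<open>
  The pair \<open>(s, \<pi>)\<close> stands for the signed permutation \<open>e\<^sub>i \<mapsto> s (\<pi> i) e\<^bsub>\<pi> i\<^esub>\<close>, acting in the same
  way on the \<open>x\<^sub>i\<close> and on the \<open>y\<^sub>i\<close>.
\<close>

type_synonym 'i sperm = "('i \<Rightarrow> complex) \<times> ('i \<Rightarrow> 'i)"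

fun act_var :: "'i sperm \<Rightarrow> 'i var \<Rightarrow> 'i pol" where
  "act_var (s, \<pi>) (X i) = Const (s (\<pi> i)) * Var (X (\<pi> i))"
| "act_var (s, \<pi>) (Y i) = Const (s (\<pi> i)) * Var (Y (\<pi> i))"

definition act :: "'i sperm \<Rightarrow> 'i pol \<Rightarrow> 'i pol" where
  "act w = subst (act_var w)"

definition invariants :: "'i pol set \<Rightarrow> 'i sperm set \<Rightarrow> 'i pol set" where
  "invariants S W = {f \<in> S. \<forall>w\<in>W. act w f = f}"

definition W_A2 :: "3 sperm set" where
  "W_A2 = {(\<lambda>_. 1, \<pi>) | \<pi>. bij \<pi>}"

definition W_B2 :: "2 sperm set" where
  "W_B2 = {(s, \<pi>). (\<forall>i. s i \<in> {1, -1}) \<and> bij \<pi>}"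

text \<open>
  Here \<open>-Id\<close> is the restriction to \<open>S\<^sub>A\<close> of the automorphism that changes the signs of all variables;
  see \<open>act_minus_Id\<close> below.
\<close>

definition W_G2 :: "3 sperm set" where
  "W_G2 = {(\<lambda>_. e, \<pi>) | e \<pi>. e \<in> {1, -1} \<and> bij \<pi>}"

definition S_A :: "3 pol set" where
  "S_A = subalgebra
     {Var (X 1) - Var (X 2), Var (X 1) - Var (X 3), Var (Y 1) - Var (Y 2), Var (Y 1) - Var (Y 3)}"

definition S_B :: "2 pol set" where
  "S_B = UNIV"

section \<open>Basic properties\<close>

lemma UNIV_2: "(UNIV :: 2 set) = {1, 2}"
proof -
  have "x = 1 \<or> x = 2" for x :: 2
  proof (induct x)
    case (of_int z)
    then have "z = 0 \<or> z = 1" by fastforce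
    then show ?case by auto
  qed
  then show ?thesis by auto
qed

lemma UNIV_3: "(UNIV :: 3 set) = {1, 2, 3}"
proof -
  have "x = 1 \<or> x = 2 \<or> x = 3" for x :: 3
  proof (induct x)
    case (of_int z)
    then have "z = 0 \<or> z = 1 \<or> z = 2" by fastforce
    then show ?case by auto
  qed
  then show ?thesis by auto
qed

lemma vector_space_scale: "vector_space scale"
  by unfold_locales
    (auto simp: scale_def Const_def algebra_simps single_add mult_single
          simp flip: mult.assoc)

lemma pol_induct [case_names zero add monomial]:
  fixes f :: "'i pol"
  assumes "P 0" and "\<And>f g. P f \<Longrightarrow> P g \<Longrightarrow> P (f + g)"
    and "\<And>m c. P (Poly_Mapping.single m c)"
  shows "P f"
proof -
  have f: "f = (\<Sum>m\<in>Poly_Mapping.keys f. Poly_Mapping.single m (Poly_Mapping.lookup f m))"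
    by (rule poly_mapping_eqI)
       (auto simp: lookup_sum lookup_single when_def sum.delta in_keys_iff)
  have "P (\<Sum>m\<in>A. Poly_Mapping.single m (Poly_Mapping.lookup f m))" if "finite A" for A
    using that by induction (auto intro: assms)
  from this[of "Poly_Mapping.keys f"] show ?thesis
    using f by simp
qed

lemma pdiff_add: "pdiff v (f + g) = pdiff v f + pdiff v g"
  unfolding pdiff_def by (rule setsum_keys_plus_distrib) (auto simp: algebra_simps single_add)

lemma pdiff_single:
  "pdiff v (Poly_Mapping.single m c) =
     Poly_Mapping.single (m - Poly_Mapping.single v 1) (of_nat (Poly_Mapping.lookup m v) * c)"
  by (cases "c = 0") (auto simp: pdiff_def)

lemma pdiff_Var: "pdiff v (Var w) = (if v = w then 1 else 0)"
  by (auto simp: Var_def pdiff_single lookup_single when_def)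

lemma pdiff_mult: "pdiff v (f * g) = pdiff v f * g + f * pdiff v g"
proof (induction f rule: pol_induct)
  case zero
  show ?case by (simp add: pdiff_def)
next
  case (add f1 f2)
  then show ?case by (simp add: algebra_simps pdiff_add)
next
  case (monomial m c)
  show ?case
  proof (induction g rule: pol_induct)
    case zero
    show ?case by (simp add: pdiff_def)
  next
    case (add g1 g2)
    then show ?case by (simp add: algebra_simps pdiff_add)
  next
    case (monomial n d)
    have shift: "(m + n) - Poly_Mapping.single v 1 = (m - Poly_Mapping.single v 1) + n"
      if "Poly_Mapping.lookup m v \<noteq> 0" for m n :: "'a var \<Rightarrow>\<^sub>0 nat"
      using that by (intro poly_mapping_eqI) (auto simp: lookup_add lookup_minus lookup_single when_def)
    have 1: "Poly_Mapping.single ((m + n) - Poly_Mapping.single v 1) (of_nat (Poly_Mapping.lookup m v) * (c * d)) =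
       Poly_Mapping.single ((m - Poly_Mapping.single v 1) + n) (of_nat (Poly_Mapping.lookup m v) * (c * d))"
      using shift[of m n] by (cases "Poly_Mapping.lookup m v = 0") auto
    have 2: "Poly_Mapping.single ((m + n) - Poly_Mapping.single v 1) (of_nat (Poly_Mapping.lookup n v) * (c * d)) =
       Poly_Mapping.single (m + (n - Poly_Mapping.single v 1)) (of_nat (Poly_Mapping.lookup n v) * (c * d))"
      using shift[of n m] by (cases "Poly_Mapping.lookup n v = 0") (auto simp: add.commute)
    show ?case
      using 1 2 by (simp add: pdiff_single mult_single lookup_add single_add algebra_simps)
  qed
qed

lemma poisson_Var:
  "poisson (Var (X i)) (Var (Y j)) = (if i = j then 1 else 0)"
  "poisson (Var (X i)) (Var (X j)) = 0"
  "poisson (Var (Y i)) (Var (Y j)) = 0"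
proof -
  have "(\<Sum>k\<in>UNIV. (if k = i then 1 else 0) * (if k = j then 1 else 0) :: 'a pol) =
      (\<Sum>k\<in>UNIV. if k = i then if i = j then 1 else 0 else 0)"
    by (rule sum.cong) auto
  then show "poisson (Var (X i)) (Var (Y j)) = (if i = j then 1 else 0)"
    by (simp add: poisson_def pdiff_Var)
qed (simp_all add: poisson_def pdiff_Var)

lemma poisson_antisym: "poisson g f = - poisson f g"
  by (simp add: poisson_def algebra_simps flip: sum_negf)

lemma poisson_add: "poisson f (g + h) = poisson f g + poisson f h"
  by (simp add: poisson_def pdiff_add algebra_simps flip: sum.distrib)

lemma poisson_mult: "poisson f (g * h) = poisson f g * h + g * poisson f h"
  by (simp add: poisson_def pdiff_mult sum_distrib_left sum_distrib_right algebra_simps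
      flip: sum.distrib)

lemma subst_add: "subst \<sigma> (f + g) = subst \<sigma> f + subst \<sigma> g"
  unfolding subst_def
  by (rule setsum_keys_plus_distrib) (auto simp: algebra_simps Const_def single_add)

lemma subst_single:
  "subst \<sigma> (Poly_Mapping.single m c) =
     Const c * (\<Prod>v\<in>Poly_Mapping.keys m. \<sigma> v ^ Poly_Mapping.lookup m v)"
  by (cases "c = 0") (auto simp: subst_def Const_def)

lemma Const_mult: "Const (c * d) = Const c * Const d"
  by (simp add: Const_def mult_single)

lemma subst_Const: "subst \<sigma> (Const c) = Const c"
  using subst_single[of \<sigma> 0 c] by (simp add: Const_def)

lemma subst_one: "subst \<sigma> 1 = 1"
  using subst_Const[of \<sigma> 1] by (simp add: Const_def)

lemma subst_Var: "subst \<sigma> (Var v) = \<sigma> v"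
  by (simp add: Var_def subst_single) (simp add: Const_def)

lemma subst_mult: "subst \<sigma> (f * g) = subst \<sigma> f * subst \<sigma> g"
proof (induction f rule: pol_induct)
  case zero
  show ?case by (simp add: subst_def)
next
  case (add f1 f2)
  then show ?case by (simp add: algebra_simps subst_add)
next
  case (monomial m c)
  show ?case
  proof (induction g rule: pol_induct)
    case zero
    show ?case by (simp add: subst_def)
  next
    case (add g1 g2)
    then show ?case by (simp add: algebra_simps subst_add)
  next
    case (monomial n d)
    let ?K = "Poly_Mapping.keys m \<union> Poly_Mapping.keys n"
    have extend: "(\<Prod>v\<in>Poly_Mapping.keys k. \<sigma> v ^ Poly_Mapping.lookup k v) =
        (\<Prod>v\<in>?K. \<sigma> v ^ Poly_Mapping.lookup k v)" if "Poly_Mapping.keys k \<subseteq> ?K" for k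
      using that by (intro prod.mono_neutral_left) (auto simp: in_keys_iff)
    have "(\<Prod>v\<in>Poly_Mapping.keys (m + n). \<sigma> v ^ Poly_Mapping.lookup (m + n) v) =
        (\<Prod>v\<in>Poly_Mapping.keys m. \<sigma> v ^ Poly_Mapping.lookup m v) *
        (\<Prod>v\<in>Poly_Mapping.keys n. \<sigma> v ^ Poly_Mapping.lookup n v)"
      using extend[of m] extend[of n] extend[of "m + n"] keys_add[of m n]
      by (simp add: lookup_add power_add prod.distrib)
    then show ?case
      by (simp add: mult_single subst_single Const_mult algebra_simps)
  qed
qed

lemma act_minus_Id:
  assumes "f \<in> {Var (X i) - Var (X j), Var (Y i) - Var (Y j)}"
  shows "act (\<lambda>_. - 1, id) f = - f"
proof -
  have diff: "subst \<sigma> (g - h) = subst \<sigma> g - subst \<sigma> h" for \<sigma> :: "'a var \<Rightarrow> 'a pol" and g h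
    using subst_add[of \<sigma> "g - h" h] by (simp add: algebra_simps)
  have "Const (- 1) = (- 1 :: 'a pol)"
    by (simp add: Const_def single_uminus)
  then show ?thesis
    using assms by (auto simp: act_def diff subst_Var)
qed

lemma zero_in_subalgebra: "0 \<in> subalgebra G"
  using subalgebra.const[of 0 G] by (simp add: Const_def)

lemma one_in_subalgebra: "1 \<in> subalgebra G"
  using subalgebra.const[of 1 G] by (simp add: Const_def)

lemma uminus_in_subalgebra: "f \<in> subalgebra G \<Longrightarrow> - f \<in> subalgebra G"
  using subalgebra.mult[OF subalgebra.const[of "- 1"], of f G]
  by (simp add: Const_def single_uminus)

lemma cring_alg:
  assumes "0 \<in> P" "1 \<in> P" "\<And>f g. f \<in> P \<Longrightarrow> g \<in> P \<Longrightarrow> f + g \<in> P"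
    "\<And>f g. f \<in> P \<Longrightarrow> g \<in> P \<Longrightarrow> f * g \<in> P" "\<And>f. f \<in> P \<Longrightarrow> - f \<in> P"
  shows "cring (alg P)"
proof (rule cringI)
  show "abelian_group (alg P)"
  proof (rule abelian_groupI)
    show "\<exists>g\<in>carrier (alg P). g \<oplus>\<^bsub>alg P\<^esub> f = \<zero>\<^bsub>alg P\<^esub>" if "f \<in> carrier (alg P)" for f
      using that assms(5)[of f] by (intro bexI[of _ "- f"]) (auto simp: alg_def)
  qed (use assms in \<open>auto simp: alg_def algebra_simps\<close>)
  show "Group.comm_monoid (alg P)"
    by (rule comm_monoidI) (use assms in \<open>auto simp: alg_def algebra_simps\<close>)
qed (use assms in \<open>auto simp: alg_def algebra_simps\<close>)

lemma cring_invariants: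
  "cring (alg (invariants (subalgebra G) W))"
  "cring (alg (invariants UNIV W))"
proof -
  have zero: "act w 0 = 0" for w :: "'a sperm"
    by (simp add: act_def subst_def)
  have uminus: "act w (- f) = - act w f" for w :: "'a sperm" and f
    using subst_add[of "act_var w" f "- f"] zero[of w] by (simp add: act_def eq_neg_iff_add_eq_0 add.commute)
  show "cring (alg (invariants (subalgebra G) W))" "cring (alg (invariants UNIV W))"
    by (rule cring_alg; auto simp: invariants_def zero uminus
          intro: zero_in_subalgebra one_in_subalgebra uminus_in_subalgebra subalgebra.intros;
        auto simp: act_def subst_add subst_mult subst_one)+
qed

lemma cring_invariants_SA: "cring (alg (invariants S_A W))"
  unfolding S_A_def by (rule cring_invariants)

lemma cring_invariants_SB: "cring (alg (invariants S_B W))"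
  unfolding S_B_def by (rule cring_invariants)

end

(* The quadratic invariants span a copy of sl_2 under the bracket, and sl_2 acts by brackets on all the
   invariants.

   (b), (c): Let D be the determinant x_1 y_2 - x_2 y_1 on the two-dimensional reflection representation.
   By Lagrange's identity D^2 is a combination of products of quadratic invariants, which are themselves
   brackets.  If -1 belongs to the group, all invariants have even degree, so in degree 4 only brackets of
   a quadratic with a quartic invariant occur.  These are killed by the sl_2-invariant functional "apply
   the square of the operator dual to D and evaluate at 0", which does not kill D^2.

   (a): By the Capelli identity, D times its dual operator is a nonzero scalar on polynomials of a given
   positive degree, up to the image of sl_2.  Hence every polynomial is a combination of powers of D modulo
   the image of sl_2, and after symmetrization every invariant is a combination of even powers of D modulo
   brackets.  Positive even powers of D are brackets, by contracting the cubic invariants with their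
   multiples by powers of D.  Conversely a bracket has no constant term, because there is no nonzero linear
   invariant. *)
theory Submission
  imports Defs "HOL-Combinatorics.Transposition"
begin

interpretation pol: vector_space "scale :: complex \<Rightarrow> 'i pol \<Rightarrow> 'i pol"
  by (rule vector_space_scale)

section \<open>Derivatives, constant terms and the action of signed permutations\<close>

lemma pdiff_zero [simp]: "pdiff v 0 = 0"
  by (simp add: pdiff_def)

lemma pdiff_Const [simp]: "pdiff v (Const c) = 0"
  by (simp add: Const_def pdiff_single)

lemma Const_one: "Const 1 = 1"
  by (simp add: Const_def)

lemma pdiff_one [simp]: "pdiff v 1 = 0"
  using pdiff_Const[of v 1] by (simp only: Const_one)

lemma pdiff_uminus: "pdiff v (- f) = - pdiff v f"
  using pdiff_add[of v f "- f"] by (simp add: eq_neg_iff_add_eq_0 add.commute)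

lemma pdiff_diff: "pdiff v (f - g) = pdiff v f - pdiff v g"
  using pdiff_add[of v f "- g"] by (simp add: pdiff_uminus)

lemma pdiff_numeral [simp]: "pdiff v (numeral n) = 0"
  by (induction n) (simp_all only: numeral.simps pdiff_add pdiff_one add_0)

lemma pdiff_power: "pdiff v (f ^ n) = of_nat n * f ^ (n - 1) * pdiff v f"
proof (induction n)
  case (Suc n)
  then show ?case
    by (cases n) (simp_all add: pdiff_mult algebra_simps)
qed simp

lemma pdiff_commute: "pdiff v (pdiff w f) = pdiff w (pdiff v f)"
proof (induction f rule: pol_induct)
  case (monomial m c)
  show ?case
    by (cases "v = w") (simp_all add: pdiff_single lookup_minus lookup_single when_def
        diff_diff_add add.commute mult.left_commute)
qed (simp_all add: pdiff_add)

lemma Const_add: "Const (c + d) = Const c + Const d"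
  by (simp add: Const_def single_add)

text \<open>Identities between maps compatible with sums and products, such as \<open>act\<close>
  and \<open>pdiff\<close>, then need checking on constants and variables only.\<close>

lemma pol_var_induct [case_names Const Var add mult]:
  fixes f :: "'i pol"
  assumes "\<And>c. P (Const c)" and "\<And>v. P (Var v)"
    and add: "\<And>f g. P f \<Longrightarrow> P g \<Longrightarrow> P (f + g)"
    and mult: "\<And>f g. P f \<Longrightarrow> P g \<Longrightarrow> P (f * g)"
  shows "P f"
proof (induction f rule: pol_induct)
  case zero
  show ?case
    using assms(1)[of 0] by (simp add: Const_def)
next
  case (monomial m c)
  have pow: "P (Poly_Mapping.single (Poly_Mapping.single v k) 1)" for v k
  proof (induction k)
    case 0
    show ?case
      using assms(1)[of 1] by (simp add: Const_def)
  next
    case (Suc k)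
    then show ?case
      using mult[OF assms(2)[of v] Suc] by (simp add: Var_def mult_single single_add[symmetric])
  qed
  have "P (Poly_Mapping.single (\<Sum>v\<in>A. Poly_Mapping.single v (Poly_Mapping.lookup m v)) 1)"
    if "finite A" for A
    using that
  proof induction
    case empty
    show ?case
      using assms(1)[of 1] by (simp add: Const_def)
  next
    case (insert v A)
    then show ?case
      using mult[OF pow[of v "Poly_Mapping.lookup m v"] insert.IH] by (simp add: mult_single)
  qed
  from this[of "Poly_Mapping.keys m"]
  have "P (Poly_Mapping.single (\<Sum>v\<in>Poly_Mapping.keys m. Poly_Mapping.single v (Poly_Mapping.lookup m v)) 1)"
    by simp
  moreover have "(\<Sum>v\<in>Poly_Mapping.keys m. Poly_Mapping.single v (Poly_Mapping.lookup m v)) = m"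
    by (rule poly_mapping_eqI)
       (auto simp: lookup_sum lookup_single when_def sum.delta in_keys_iff)
  ultimately show ?case
    using mult[OF assms(1)[of c], of "Poly_Mapping.single m 1"] by (simp add: Const_def mult_single)
qed (rule add)

abbreviation const_term :: "'i pol \<Rightarrow> complex" where
  "const_term f \<equiv> Poly_Mapping.lookup f 0"

lemma const_term_Const [simp]: "const_term (Const c) = c"
  by (simp add: Const_def)

lemma const_term_mult: "const_term (f * g) = const_term f * const_term g"
proof (induction f rule: pol_induct)
  case (monomial m c)
  show ?case
  proof (induction g rule: pol_induct)
    case (monomial n d)
    have "m + n = 0 \<longleftrightarrow> m = 0 \<and> n = 0"
      by (auto simp: poly_mapping_eq_iff fun_eq_iff lookup_add)
    then show ?case
      by (auto simp: mult_single lookup_single when_def)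
  qed (simp_all add: lookup_add algebra_simps)
qed (simp_all add: lookup_add algebra_simps)

lemma const_term_Var [simp]: "const_term (Var v) = 0"
  by (auto simp: Var_def lookup_single when_def poly_mapping_eq_iff fun_eq_iff)

lemma act_simps:
  "act w (Const c) = Const c" "act w 1 = 1" "act w (f + g) = act w f + act w g"
  "act w (f * g) = act w f * act w g" "act w (Var v) = act_var w v" "act w 0 = 0"
  by (simp_all add: act_def subst_Const subst_one subst_add subst_mult subst_Var)
     (simp add: subst_def)

lemma act_uminus: "act w (- f) = - act w f"
  using act_simps(3)[of w f "- f"] by (simp add: eq_neg_iff_add_eq_0 add.commute act_simps(6))

lemma act_diff: "act w (f - g) = act w f - act w g"
  using act_simps(3)[of w f "- g"] by (simp add: act_uminus)

lemma act_sum: "act w (\<Sum>i\<in>A. f i) = (\<Sum>i\<in>A. act w (f i))"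
  by (induction A rule: infinite_finite_induct) (simp_all add: act_simps)

lemma act_numeral: "act w (numeral n) = numeral n"
  by (induction n) (simp_all only: numeral.simps act_simps)

lemma act_power: "act w (f ^ n) = act w f ^ n"
  by (induction n) (simp_all add: act_simps)

lemma act_scale: "act w (scale c f) = scale c (act w f)"
  by (simp add: scale_def act_simps)

lemma const_term_act: "const_term (act w f) = const_term f"
proof (induction f rule: pol_var_induct)
  case (Var v)
  then show ?case
    by (cases w; cases v) (simp_all add: act_simps const_term_mult)
qed (simp_all add: act_simps const_term_mult lookup_add)

text \<open>Chain rule: since \<open>\<pi>\<close> is injective, a variable with index
  \<open>\<pi> i\<close> occurs only in the image of the variable with index \<open>i\<close>, with
  coefficient \<open>s (\<pi> i)\<close>.\<close>

lemma pdiff_act: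
  assumes "inj \<pi>"
  shows "pdiff (X (\<pi> i)) (act (s, \<pi>) f) = Const (s (\<pi> i)) * act (s, \<pi>) (pdiff (X i) f)"
    and "pdiff (Y (\<pi> i)) (act (s, \<pi>) f) = Const (s (\<pi> i)) * act (s, \<pi>) (pdiff (Y i) f)"
proof (induction f rule: pol_var_induct)
  case (Var v)
  { case 1 show ?case using assms
      by (cases v) (auto simp: act_simps pdiff_mult pdiff_Var inj_eq)
  next case 2 show ?case using assms
      by (cases v) (auto simp: act_simps pdiff_mult pdiff_Var inj_eq) }
qed (simp_all add: act_simps pdiff_mult pdiff_add algebra_simps)

text \<open>Signed permutations are symplectic: x_i and y_i receive the same sign, so each summand
  of the bracket carries a squared sign, and \<open>\<pi>\<close> merely reorders the
  summands.\<close>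

lemma poisson_act:
  fixes \<pi> :: "'i::finite \<Rightarrow> 'i"
  assumes "bij \<pi>" and "\<And>i. s i ^ 2 = 1"
  shows "poisson (act (s, \<pi>) f) (act (s, \<pi>) g) = act (s, \<pi>) (poisson f g)"
proof -
  let ?h = "\<lambda>i. pdiff (X i) (act (s, \<pi>) f) * pdiff (Y i) (act (s, \<pi>) g) -
      pdiff (Y i) (act (s, \<pi>) f) * pdiff (X i) (act (s, \<pi>) g)"
  have inj: "inj \<pi>" using assms(1) by (rule bij_is_inj)
  have sq: "Const (s i) * p * (Const (s i) * q) = p * q" for i :: 'i and p q :: "'i pol"
  proof -
    have "Const (s i) * p * (Const (s i) * q) = Const (s i ^ 2) * (p * q)"
      by (simp add: power2_eq_square Const_mult algebra_simps)
    then show ?thesis by (simp add: assms(2) Const_one)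
  qed
  have "poisson (act (s, \<pi>) f) (act (s, \<pi>) g) = (\<Sum>i\<in>UNIV. ?h i)"
    by (simp add: poisson_def)
  also have "\<dots> = (\<Sum>i\<in>UNIV. ?h (\<pi> i))"
    using sum.reindex_bij_betw[OF assms(1), of ?h] by simp
  also have "\<dots> = act (s, \<pi>) (poisson f g)"
    by (simp add: poisson_def act_sum act_diff act_simps pdiff_act[OF inj] sq)
  finally show ?thesis .
qed

lemma poisson_sum_right: "poisson f (\<Sum>i\<in>A. g i) = (\<Sum>i\<in>A. poisson f (g i))"
  by (induction A rule: infinite_finite_induct) (simp_all add: poisson_add, simp_all add: poisson_def)

section \<open>The operator dual to x_i y_j - x_j y_i, and its square on brackets\<close>

definition nabla :: "'i \<Rightarrow> 'i \<Rightarrow> 'i pol \<Rightarrow> 'i pol" where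
  "nabla i j f = pdiff (X i) (pdiff (Y j) f) - pdiff (X j) (pdiff (Y i) f)"

lemma pdiff_scale: "pdiff v (scale c f) = scale c (pdiff v f)"
  by (simp add: scale_def pdiff_mult)

lemma nabla_linear:
  "nabla i j 0 = 0" "nabla i j (f + g) = nabla i j f + nabla i j g"
  "nabla i j (f - g) = nabla i j f - nabla i j g"
  "nabla i j (scale c f) = scale c (nabla i j f)"
  by (simp_all add: nabla_def pdiff_add pdiff_diff pdiff_scale pol.scale_right_diff_distrib)

lemma nabla_sum: "nabla i j (\<Sum>k\<in>A. f k) = (\<Sum>k\<in>A. nabla i j (f k))"
  by (induction A rule: infinite_finite_induct) (simp_all add: nabla_linear)

lemma Const_numeral: "Const (numeral n) = numeral n"
  by (induction n) (simp_all only: numeral.simps Const_one Const_add)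

lemma const_term_numeral [simp]: "const_term (numeral n) = numeral n"
  by (metis Const_numeral const_term_Const)

lemma const_term_scale: "const_term (scale c f) = c * const_term f"
  by (simp add: scale_def const_term_mult)

text \<open>One of the four derivatives in a fixed copy of \<open>nabla\<close> falls on
  \<open>p\<close>, all others on \<open>r\<close>. The two copies in the square of
  \<open>nabla\<close> contribute equally, whence the factor 2 below.\<close>

definition nabla_pairing :: "'i \<Rightarrow> 'i \<Rightarrow> 'i pol \<Rightarrow> 'i pol \<Rightarrow> complex" where
  "nabla_pairing i j p r =
     const_term (pdiff (X i) p) * const_term (nabla i j (pdiff (Y j) r)) +
     const_term (pdiff (Y j) p) * const_term (nabla i j (pdiff (X i) r)) -
     const_term (pdiff (X j) p) * const_term (nabla i j (pdiff (Y i) r)) -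
     const_term (pdiff (Y i) p) * const_term (nabla i j (pdiff (X j) r))"

text \<open>
  If \<open>p\<close> and \<open>r\<close> vanish at \<open>0\<close> together with the second derivatives of \<open>p\<close>, then in the Leibniz expansion
  of \<open>\<nabla>\<^sup>2 (p r)\<close> at \<open>0\<close> only the terms survive in which one factor is differentiated once and
  the other three times.
\<close>
lemma const_term_nabla_nabla_mult:
  assumes "const_term p = 0" "const_term r = 0"
    and "\<And>u v. const_term (pdiff u (pdiff v p)) = 0"
  shows "const_term (nabla i j (nabla i j (p * r))) =
    2 * (nabla_pairing i j p r + nabla_pairing i j r p)"
  by (simp add: nabla_def nabla_pairing_def pdiff_mult pdiff_add pdiff_diff const_term_mult
      lookup_add lookup_minus assms pdiff_commute algebra_simps)

abbreviation even_pol :: "'i pol \<Rightarrow> bool" where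
  "even_pol f \<equiv> act (\<lambda>_. - 1, id) f = f"

lemma Const_minus_one: "Const (- 1) = - 1"
  by (simp add: Const_def single_uminus)

lemma act_minus_one_pdiff:
  "act (\<lambda>_. - 1, id) (pdiff v f) = - pdiff v (act (\<lambda>_. - 1, id) f)"
  using pdiff_act[of id _ "\<lambda>_. - 1" f] by (cases v) (auto simp: Const_minus_one)

lemma even_pol_const_term_pdiff:
  assumes "even_pol f"
  shows "const_term (pdiff v f) = 0"
    and "const_term (pdiff u (pdiff v (pdiff w f))) = 0"
  using const_term_act[of "(\<lambda>_. - 1, id)" "pdiff v f"]
    const_term_act[of "(\<lambda>_. - 1, id)" "pdiff u (pdiff v (pdiff w f))"] assms
  by (simp_all add: act_minus_one_pdiff pdiff_uminus)

text \<open>This sees only the Hessian of \<open>f\<close> at 0 and the fourth derivatives of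
  \<open>g\<close> at 0. It is half the value at 0 of the square of \<open>nabla\<close> on the
  bracket of the quadratic part of \<open>f\<close> with the quartic part of
  \<open>g\<close>.\<close>

definition bracket_pairing :: "'i::finite \<Rightarrow> 'i \<Rightarrow> 'i pol \<Rightarrow> 'i pol \<Rightarrow> complex" where
  "bracket_pairing i j f g =
     (\<Sum>k\<in>UNIV. nabla_pairing i j (pdiff (X k) f) (pdiff (Y k) g) -
                nabla_pairing i j (pdiff (Y k) f) (pdiff (X k) g))"

text \<open>For even polynomials the first and third derivatives vanish at 0, so the Leibniz
  expansion of \<open>const_term_nabla_nabla_mult\<close> applies to each product in the
  bracket.\<close>

lemma const_term_nabla_nabla_poisson:
  assumes "even_pol f" "even_pol g"
  shows "const_term (nabla i j (nabla i j (poisson f g))) =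
    2 * (bracket_pairing i j f g - bracket_pairing i j g f)"
proof -
  have "const_term (nabla i j (nabla i j (poisson f g))) =
    (\<Sum>k\<in>UNIV. const_term (nabla i j (nabla i j (pdiff (X k) f * pdiff (Y k) g))) -
               const_term (nabla i j (nabla i j (pdiff (Y k) f * pdiff (X k) g))))"
    by (simp add: poisson_def nabla_sum nabla_linear lookup_sum lookup_minus)
  also have "\<dots> = (\<Sum>k\<in>UNIV.
      2 * (nabla_pairing i j (pdiff (X k) f) (pdiff (Y k) g) -
           nabla_pairing i j (pdiff (Y k) f) (pdiff (X k) g)) -
      2 * (nabla_pairing i j (pdiff (X k) g) (pdiff (Y k) f) -
           nabla_pairing i j (pdiff (Y k) g) (pdiff (X k) f)))"
    using assms
    by (intro sum.cong) (simp_all add: const_term_nabla_nabla_mult even_pol_const_term_pdiff algebra_simps)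
  finally show ?thesis
    by (simp add: bracket_pairing_def sum_subtractf flip: sum_distrib_left)
qed

text \<open>The Hessian at 0 of an invariant polynomial is an invariant bilinear form. This is what
  pins down its entries in each type.\<close>

lemma const_term_pdiff2_act:
  assumes "inj \<pi>" "act (s, \<pi>) f = f" "c \<in> {X, Y}" "d \<in> {X, Y}"
  shows "const_term (pdiff (c (\<pi> i)) (pdiff (d (\<pi> j)) f)) =
    s (\<pi> i) * s (\<pi> j) * const_term (pdiff (c i) (pdiff (d j) f))"
proof -
  have act: "pdiff (e (\<pi> k)) (act (s, \<pi>) g) = Const (s (\<pi> k)) * act (s, \<pi>) (pdiff (e k) g)"
    if "e \<in> {X, Y}" for e k g
    using that pdiff_act[OF assms(1), of k s g] by auto
  have "pdiff (c (\<pi> i)) (pdiff (d (\<pi> j)) f) =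
      Const (s (\<pi> j)) * (Const (s (\<pi> i)) * act (s, \<pi>) (pdiff (c i) (pdiff (d j) f)))"
    using act[OF assms(4), of j f] act[OF assms(3), of i "pdiff (d j) f"]
    by (simp add: assms(2) pdiff_mult)
  then show ?thesis
    by (simp add: const_term_mult const_term_act)
qed

lemma bracket_span_subspace: "pol.subspace (bracket_span P)"
  by (simp add: bracket_span_def pol.subspace_span)

lemmas bracket_span_add = pol.subspace_add[OF bracket_span_subspace]
  and bracket_span_scale = pol.subspace_scale[OF bracket_span_subspace]
  and bracket_span_diff = pol.subspace_diff[OF bracket_span_subspace]
  and bracket_span_zero = pol.subspace_0[OF bracket_span_subspace]
  and bracket_span_neg = pol.subspace_neg[OF bracket_span_subspace]

lemma poisson_in_bracket_span: "f \<in> P \<Longrightarrow> g \<in> P \<Longrightarrow> poisson f g \<in> bracket_span P"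
  unfolding bracket_span_def by (rule pol.span_base) blast

lemma bracket_span_subset:
  assumes "pol.subspace V" "\<And>f g. f \<in> P \<Longrightarrow> g \<in> P \<Longrightarrow> poisson f g \<in> V"
  shows "bracket_span P \<subseteq> V"
  unfolding bracket_span_def using assms by (intro pol.span_minimal) auto

lemma const_term_nabla_nabla_bracket_span:
  assumes even: "\<And>f. f \<in> P \<Longrightarrow> even_pol f"
    and zero: "\<And>f g. f \<in> P \<Longrightarrow> g \<in> P \<Longrightarrow> bracket_pairing i j f g = 0"
    and h: "h \<in> bracket_span P"
  shows "const_term (nabla i j (nabla i j h)) = 0"
proof -
  have "bracket_span P \<subseteq> {h. const_term (nabla i j (nabla i j h)) = 0}"
  proof (rule bracket_span_subset)
    show "pol.subspace {h. const_term (nabla i j (nabla i j h)) = 0}"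
      by (rule pol.subspaceI)
        (auto simp: nabla_linear lookup_add const_term_scale)
  qed (auto simp: const_term_nabla_nabla_poisson even zero)
  with h show ?thesis by blast
qed

text \<open>To be applied to the quadratic invariants formed from x with x, x with y, and y with y.
  By Lagrange's identity \<open>p * r - q ^ 2\<close> is then a multiple of the squared
  determinant.\<close>

lemma ideal_bracket_span_disc:
  assumes "ideal (bracket_span P) (alg P)"
    and "p \<in> bracket_span P" "q \<in> bracket_span P" "r \<in> bracket_span P" "q \<in> P" "r \<in> P"
  shows "p * r - q ^ 2 \<in> bracket_span P"
proof -
  interpret ideal "bracket_span P" "alg P" by (rule assms(1))
  have "p * r \<in> bracket_span P" "q * q \<in> bracket_span P"
    using I_r_closed[OF assms(2), of r] I_r_closed[OF assms(3), of q] assms(5,6)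
    by (simp_all add: alg_def)
  then show ?thesis
    by (simp add: bracket_span_diff power2_eq_square)
qed

lemma scale_simps: "scale 0 f = 0" "scale 1 f = f" "scale (- c) f = - scale c f"
  "scale (numeral n) f = numeral n * f"
  by (simp_all add: scale_def Const_numeral Const_one) (simp_all add: Const_def single_uminus)

lemma scale_numeral_cancel:
  assumes "pol.subspace V" "numeral n * f \<in> V"
  shows "f \<in> V"
proof -
  have "scale (1 / numeral n) (scale (numeral n) f) \<in> V"
    using assms unfolding scale_simps(4) by (rule pol.subspace_scale)
  then show ?thesis by simp
qed

lemma cancel_numeral_in_bracket_span:
  "g \<in> bracket_span P \<Longrightarrow> g = numeral n * f \<Longrightarrow> f \<in> bracket_span P"
  using scale_numeral_cancel[OF bracket_span_subspace] by blast

section \<open>Type \<open>B\<^sub>2\<close>\<close>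

abbreviation R_B :: "2 pol set" where "R_B \<equiv> invariants S_B W_B2"

definition B_quadratic :: "(2 \<Rightarrow> 2 var) \<Rightarrow> (2 \<Rightarrow> 2 var) \<Rightarrow> 2 pol" where
  "B_quadratic c d = (\<Sum>i\<in>UNIV. Var (c i) * Var (d i))"

text \<open>Changing the sign at index 1 negates the mixed entries, and transposing the indices
  exchanges the diagonal ones. So each block of the Hessian is a scalar matrix, as for a combination
  of the \<open>B_quadratic\<close>.\<close>

lemma R_B_hessian:
  assumes "f \<in> R_B" "c \<in> {X, Y}" "d \<in> {X, Y}"
  shows "const_term (pdiff (c 1) (pdiff (d 2) f)) = 0"
    and "const_term (pdiff (c 2) (pdiff (d 1) f)) = 0"
    and "const_term (pdiff (c 2) (pdiff (d 2) f)) = const_term (pdiff (c 1) (pdiff (d 1) f))"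
proof -
  have "act (\<lambda>i. if i = 1 then - 1 else 1, id) f = f" "act (\<lambda>_. 1, transpose 1 2) f = f"
    using assms(1) by (auto simp: invariants_def W_B2_def)
  note 1 = const_term_pdiff2_act[OF inj_on_id this(1) assms(2,3)]
  note 2 = const_term_pdiff2_act[OF _ \<open>act (\<lambda>_. 1, transpose 1 2) f = f\<close> assms(2,3), of 1 1]
  show "const_term (pdiff (c 1) (pdiff (d 2) f)) = 0"
    using 1[of 1 2] by (simp add: id_def)
  show "const_term (pdiff (c 2) (pdiff (d 1) f)) = 0"
    using 1[of 2 1] by (simp add: id_def)
  show "const_term (pdiff (c 2) (pdiff (d 2) f)) = const_term (pdiff (c 1) (pdiff (d 1) f))"
    using 2 by simp
qed

text \<open>By \<open>R_B_hessian\<close> the quadratic part of \<open>f\<close> lies in sl_2, whose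
  brackets commute with \<open>nabla 1 2\<close>; and a bracket with a quadratic form has no
  constant term. In coordinates, all terms cancel once the Hessian is inserted.\<close>

lemma R_B_bracket_pairing:
  assumes "f \<in> R_B" "g \<in> R_B"
  shows "bracket_pairing 1 2 f g = 0"
  by (simp add: bracket_pairing_def nabla_pairing_def UNIV_2 R_B_hessian[OF assms(1)] pdiff_commute
      pdiff_diff pdiff_add nabla_def lookup_add lookup_minus algebra_simps)

lemma B_quadratic_in_R_B:
  assumes "c \<in> {X, Y}" "d \<in> {X, Y}"
  shows "B_quadratic c d \<in> R_B"
proof -
  have "act (s, \<pi>) (B_quadratic c d) = B_quadratic c d"
    if "bij \<pi>" and s: "\<forall>i. s i \<in> {1, - 1}" for s \<pi>
  proof -
    have sq: "Const (s i) * p * (Const (s i) * q) = p * q" for i p q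
      using s[rule_format, of i] by (auto simp: Const_one Const_minus_one)
    have "act (s, \<pi>) (B_quadratic c d) = (\<Sum>i\<in>UNIV. Var (c (\<pi> i)) * Var (d (\<pi> i)))"
      using assms by (auto simp: B_quadratic_def act_sum act_simps sq)
    also have "\<dots> = B_quadratic c d"
      using sum.reindex_bij_betw[OF that(1), of "\<lambda>i. Var (c i) * Var (d i)"] by (simp add: B_quadratic_def)
    finally show ?thesis .
  qed
  then show ?thesis
    by (auto simp: invariants_def S_B_def W_B2_def)
qed

text \<open>The relations of sl_2. As this Lie algebra is perfect, every quadratic invariant is
  itself a bracket.\<close>

lemma B_quadratic_brackets:
  "poisson (B_quadratic X X) (B_quadratic X Y) = 2 * B_quadratic X X"
  "poisson (B_quadratic X X) (B_quadratic Y Y) = 4 * B_quadratic X Y"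
  "poisson (B_quadratic X Y) (B_quadratic Y Y) = 2 * B_quadratic Y Y"
  by (simp_all add: B_quadratic_def poisson_def UNIV_2 pdiff_add pdiff_mult pdiff_Var algebra_simps)

lemma pdiff_B_quadratic:
  "pdiff (X i) (B_quadratic X X) = 2 * Var (X i)" "pdiff (Y i) (B_quadratic X X) = 0"
  "pdiff (X i) (B_quadratic X Y) = Var (Y i)" "pdiff (Y i) (B_quadratic X Y) = Var (X i)"
  "pdiff (X i) (B_quadratic Y Y) = 0" "pdiff (Y i) (B_quadratic Y Y) = 2 * Var (Y i)"
proof -
  have "i = 1 \<or> i = 2"
    using UNIV_2 by auto
  then show "pdiff (X i) (B_quadratic X X) = 2 * Var (X i)" "pdiff (Y i) (B_quadratic X X) = 0"
    "pdiff (X i) (B_quadratic X Y) = Var (Y i)" "pdiff (Y i) (B_quadratic X Y) = Var (X i)"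
    "pdiff (X i) (B_quadratic Y Y) = 0" "pdiff (Y i) (B_quadratic Y Y) = 2 * Var (Y i)"
    by (auto simp: B_quadratic_def UNIV_2 pdiff_add pdiff_mult pdiff_Var)
qed

lemma not_ideal_R_B: "\<not> ideal (bracket_span R_B) (alg R_B)"
proof
  assume ideal: "ideal (bracket_span R_B) (alg R_B)"
  have bracket: "poisson (B_quadratic c d) (B_quadratic c' d') \<in> bracket_span R_B"
    if "c \<in> {X, Y}" "d \<in> {X, Y}" "c' \<in> {X, Y}" "d' \<in> {X, Y}" for c d c' d'
    using that by (intro poisson_in_bracket_span B_quadratic_in_R_B)
  let ?h = "B_quadratic X X * B_quadratic Y Y - B_quadratic X Y ^ 2"
  have "?h \<in> bracket_span R_B"
  proof (rule ideal_bracket_span_disc[OF ideal])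
    show "B_quadratic X X \<in> bracket_span R_B"
      by (rule cancel_numeral_in_bracket_span[OF bracket B_quadratic_brackets(1)]) auto
    show "B_quadratic X Y \<in> bracket_span R_B"
      by (rule cancel_numeral_in_bracket_span[OF bracket B_quadratic_brackets(2)]) auto
    show "B_quadratic Y Y \<in> bracket_span R_B"
      by (rule cancel_numeral_in_bracket_span[OF bracket B_quadratic_brackets(3)]) auto
  qed (simp_all add: B_quadratic_in_R_B)
  then have "const_term (nabla 1 2 (nabla 1 2 ?h)) = 0"
    by (rule const_term_nabla_nabla_bracket_span[rotated 2])
      (auto simp: R_B_bracket_pairing, auto simp: invariants_def W_B2_def)
  \<comment> \<open>\<open>?h\<close> is the square of x_1 y_2 - x_2 y_1. By Cayley's identity
    \<open>nabla 1 2\<close> takes it to six times the determinant, and the determinant to 2, so the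
    value is 12.\<close>
  then show False
    by (simp add: nabla_def power2_eq_square pdiff_add pdiff_diff pdiff_uminus pdiff_mult pdiff_Var
        pdiff_B_quadratic const_term_mult lookup_add lookup_minus)
qed

section \<open>The algebra \<open>S\<^sub>A\<close>\<close>

abbreviation perm :: "('i \<Rightarrow> 'i) \<Rightarrow> 'i pol \<Rightarrow> 'i pol" where
  "perm \<pi> \<equiv> act (\<lambda>_. 1, \<pi>)"

lemma S_A_subspace: "pol.subspace S_A"
  by (rule pol.subspaceI)
    (auto simp: S_A_def scale_def intro: zero_in_subalgebra subalgebra.intros)

lemma S_A_intros:
  "Const c \<in> S_A" "f \<in> S_A \<Longrightarrow> g \<in> S_A \<Longrightarrow> f + g \<in> S_A" "f \<in> S_A \<Longrightarrow> g \<in> S_A \<Longrightarrow> f * g \<in> S_A"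
  "f \<in> S_A \<Longrightarrow> g \<in> S_A \<Longrightarrow> f - g \<in> S_A" "f \<in> S_A \<Longrightarrow> - f \<in> S_A"
  "1 \<in> S_A" "0 \<in> S_A" "numeral n \<in> S_A"
  using pol.subspace_diff[OF S_A_subspace, of f g] subalgebra.const[of "numeral n"]
  by (auto simp: S_A_def Const_numeral intro: zero_in_subalgebra one_in_subalgebra
      uminus_in_subalgebra subalgebra.intros)

lemma S_A_power: "f \<in> S_A \<Longrightarrow> f ^ n \<in> S_A"
  by (induction n) (auto intro: S_A_intros)

lemma S_A_sum: "(\<And>i. i \<in> A \<Longrightarrow> f i \<in> S_A) \<Longrightarrow> (\<Sum>i\<in>A. f i) \<in> S_A"
  using pol.subspace_sum[OF S_A_subspace] by blast

lemma three_cases: "i = 1 \<or> i = 2 \<or> i = (3 :: 3)"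
  using UNIV_3 by auto

lemma Var_diff_in_S_A:
  assumes "c \<in> {X, Y}"
  shows "Var (c i) - Var (c j) \<in> S_A"
proof -
  have gen: "Var (c 1) - Var (c k) \<in> S_A" for k
    using three_cases[of k] assms
    by (auto simp: S_A_def intro: subalgebra.gen zero_in_subalgebra)
  have "Var (c i) - Var (c j) = (Var (c 1) - Var (c j)) - (Var (c 1) - Var (c i))"
    by simp
  then show ?thesis
    using S_A_intros(4)[OF gen gen] by metis
qed

lemma S_A_induct [consumes 1, case_names Const diff add mult]:
  assumes "f \<in> S_A" "\<And>c. P (Const c)"
    and "\<And>c k. c \<in> {X, Y} \<Longrightarrow> k \<in> {2, 3} \<Longrightarrow> P (Var (c 1) - Var (c k))"
    and "\<And>f g. f \<in> S_A \<Longrightarrow> g \<in> S_A \<Longrightarrow> P f \<Longrightarrow> P g \<Longrightarrow> P (f + g)"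
    and "\<And>f g. f \<in> S_A \<Longrightarrow> g \<in> S_A \<Longrightarrow> P f \<Longrightarrow> P g \<Longrightarrow> P (f * g)"
  shows "P f"
  using assms(1) unfolding S_A_def
proof induction
  case (gen g)
  then show ?case using assms(3)[of X 2] assms(3)[of X 3] assms(3)[of Y 2] assms(3)[of Y 3] by auto
qed (use assms in \<open>auto simp: S_A_def\<close>)

text \<open>Polynomials in differences are killed by the sum of the three derivatives. Solved for
  index 1, the relation serves as a rewrite rule that leaves only the indices 2 and 3.\<close>

lemma S_A_translation_invariant:
  assumes "f \<in> S_A" "c \<in> {X, Y}"
  shows "pdiff (c 1) f = - pdiff (c 2) f - pdiff (c 3) f"
  using assms(1)
proof (induction f rule: S_A_induct)
  case (diff d k)
  with assms(2) show ?case by (auto simp: pdiff_diff pdiff_Var)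
next
  case (mult f g)
  show ?case
    unfolding pdiff_mult mult.IH by (simp add: algebra_simps)
qed (simp_all add: pdiff_add)

lemma S_A_pdiff: "f \<in> S_A \<Longrightarrow> pdiff v f \<in> S_A"
proof (induction f rule: S_A_induct)
  case (diff d k)
  then show ?case by (auto simp: pdiff_diff pdiff_Var intro: S_A_intros)
qed (auto simp: pdiff_add pdiff_mult intro: S_A_intros)

lemma S_A_poisson: "f \<in> S_A \<Longrightarrow> g \<in> S_A \<Longrightarrow> poisson f g \<in> S_A"
  unfolding poisson_def by (intro S_A_sum S_A_intros S_A_pdiff)

lemma S_A_perm: "f \<in> S_A \<Longrightarrow> perm \<pi> f \<in> S_A"
proof (induction f rule: S_A_induct)
  case (diff d k)
  then show ?case by (auto simp: act_diff act_simps Const_one intro: Var_diff_in_S_A)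
qed (auto simp: act_simps intro: S_A_intros)

lemma sum_UNIV_3: "(\<Sum>i\<in>UNIV. f i) = f 1 + (f 2 + f (3 :: 3))"
  for f :: "3 \<Rightarrow> 'b::comm_monoid_add"
  unfolding UNIV_3 by (subst sum.insert, simp, simp)+ simp

text \<open>The deviation of a coordinate from the mean, scaled to avoid fractions. Unlike the
  coordinate it lies in \<open>S_A\<close>, and permutations still just permute the indices.\<close>

definition centred :: "('i::finite \<Rightarrow> 'i var) \<Rightarrow> 'i \<Rightarrow> 'i pol" where
  "centred c k = of_nat CARD('i) * Var (c k) - (\<Sum>i\<in>UNIV. Var (c i))"

text \<open>Polarized power sums: total degree 2 yields the generators of sl_2, total degree 3 the
  cubic invariants.\<close>

definition power_sum :: "nat \<Rightarrow> nat \<Rightarrow> 'i::finite pol" where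
  "power_sum m n = (\<Sum>k\<in>UNIV. centred X k ^ m * centred Y k ^ n)"

lemma act_of_nat: "act w (of_nat n) = of_nat n"
  by (induction n) (simp_all add: act_simps)

lemma perm_centred:
  assumes "bij \<pi>" "c \<in> {X, Y}"
  shows "perm \<pi> (centred c k) = centred c (\<pi> k)"
proof -
  have "perm \<pi> (Var (c i)) = Var (c (\<pi> i))" for i
    using assms(2) by (auto simp: act_simps Const_one)
  then show ?thesis
    using sum.reindex_bij_betw[OF assms(1), of "\<lambda>i. Var (c i)"]
    by (simp add: centred_def act_diff act_sum act_of_nat act_simps)
qed

lemma perm_power_sum: "bij \<pi> \<Longrightarrow> perm \<pi> (power_sum m n) = power_sum m n"
  using sum.reindex_bij_betw[of \<pi> UNIV UNIV "\<lambda>k. centred X k ^ m * centred Y k ^ n"]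
  by (simp add: power_sum_def act_sum act_simps act_power perm_centred)

lemma centred_in_S_A: "c \<in> {X, Y} \<Longrightarrow> centred c k \<in> S_A"
proof -
  assume c: "c \<in> {X, Y}"
  have "centred c k = (\<Sum>i\<in>UNIV. Var (c k) - Var (c i))"
    by (simp add: centred_def sum_subtractf)
  then show ?thesis
    using c by (auto intro!: S_A_sum Var_diff_in_S_A)
qed

lemma power_sum_in_S_A: "power_sum m n \<in> S_A"
  unfolding power_sum_def
  by (intro S_A_sum S_A_intros S_A_power centred_in_S_A) auto

lemma centred_3: "centred c (k :: 3) = 3 * Var (c k) - (Var (c 1) + Var (c 2) + Var (c 3))"
  by (simp add: centred_def sum_UNIV_3 add.assoc)

lemma pdiff_centred:
  "pdiff (X i) (centred X k :: 3 pol) = (if i = k then 2 else - 1)" "pdiff (Y i) (centred X k) = 0"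
  "pdiff (Y i) (centred Y k :: 3 pol) = (if i = k then 2 else - 1)" "pdiff (X i) (centred Y k) = 0"
  using three_cases[of i]
  by (elim disjE; simp add: centred_3 pdiff_diff pdiff_add pdiff_mult pdiff_Var)+

lemma centred_three: "centred c 3 = - centred c 1 - centred c (2 :: 3)"
  by (simp add: centred_3 algebra_simps)

lemma const_term_centred: "const_term (centred c (k :: 3)) = 0"
  by (simp add: centred_3 lookup_minus lookup_add const_term_mult)

text \<open>The derivative of a centred coordinate is 3 times a Kronecker delta, minus 1. The part
  coming from the -1 meets the sum of all derivatives of \<open>f\<close>, which is zero.\<close>

lemma power_sum_bracket:
  assumes "f \<in> S_A"
  shows "poisson (power_sum m n) f =
    3 * (\<Sum>k\<in>UNIV. of_nat m * centred X k ^ (m - 1) * centred Y k ^ n * pdiff (Y k) f -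
                    of_nat n * centred X k ^ m * centred Y k ^ (n - 1) * pdiff (X k) f)"
  by (simp add: poisson_def power_sum_def sum_UNIV_3 pdiff_add pdiff_mult pdiff_power pdiff_centred
      S_A_translation_invariant[OF assms])
     (simp add: algebra_simps)

text \<open>Polarization: up to the factor 3 hidden in \<open>centred\<close>, the four operators
  give the action of the matrix units of gl_2 on \<open>S_A\<close>.\<close>

definition polar :: "(3 \<Rightarrow> 3 var) \<Rightarrow> (3 \<Rightarrow> 3 var) \<Rightarrow> 3 pol \<Rightarrow> 3 pol" where
  "polar c d f = (\<Sum>k\<in>UNIV. centred c k * pdiff (d k) f)"

text \<open>Brackets with the quadratic invariants realize exactly sl_2 inside gl_2; the Euler
  operator \<open>polar X X\<close> + \<open>polar Y Y\<close> is the missing direction.\<close>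

lemma power_sum_quadratic_bracket:
  assumes "f \<in> S_A"
  shows "poisson (power_sum 2 0) f = 6 * polar X Y f"
    "poisson (power_sum 0 2) f = - 6 * polar Y X f"
    "poisson (power_sum 1 1) f = 3 * (polar Y Y f - polar X X f)"
  by (simp_all add: power_sum_bracket[OF assms] polar_def sum_distrib_left sum_subtractf
    sum_negf mult.assoc right_diff_distrib)

lemma pdiff_power_sum_quadratic:
  "pdiff (X k) (power_sum 2 0) = 6 * centred X (k :: 3)" "pdiff (Y k) (power_sum 2 0) = 0"
  "pdiff (X k) (power_sum 1 1) = 3 * centred Y (k :: 3)" "pdiff (Y k) (power_sum 1 1) = 3 * centred X k"
  "pdiff (X k) (power_sum 0 2) = 0" "pdiff (Y k) (power_sum 0 2) = 6 * centred Y (k :: 3)"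
  using three_cases[of k]
  by (auto simp: power_sum_def sum_UNIV_3 pdiff_add pdiff_mult pdiff_power pdiff_centred
      centred_three pdiff_diff pdiff_uminus algebra_simps)

lemma power_sum_quadratic_brackets:
  "poisson (power_sum 2 0 :: 3 pol) (power_sum 1 1) = 18 * power_sum 2 0"
  "poisson (power_sum 2 0 :: 3 pol) (power_sum 0 2) = 36 * power_sum 1 1"
  "poisson (power_sum 1 1 :: 3 pol) (power_sum 0 2) = 18 * power_sum 0 2"
  by (simp_all only: poisson_def pdiff_power_sum_quadratic)
     (simp_all add: power_sum_def power2_eq_square sum_distrib_left mult.assoc mult.left_commute)

section \<open>Type \<open>G\<^sub>2\<close>\<close>

abbreviation R_G :: "3 pol set" where "R_G \<equiv> invariants S_A W_G2"

lemma W_A2_subset: "W_A2 \<subseteq> W_G2"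
  by (auto simp: W_A2_def W_G2_def)

lemma power_sum_in_R_G:
  assumes "even (m + n)"
  shows "power_sum m n \<in> R_G"
proof -
  have "act (\<lambda>_. e, \<pi>) (power_sum m n) = power_sum m n" if "e \<in> {1, - 1}" "bij \<pi>"
    for e and \<pi> :: "3 \<Rightarrow> 3"
  proof (cases "e = 1")
    case True
    then show ?thesis by (simp add: perm_power_sum that)
  next
    case False
    then have e: "e = - 1" using that by auto
    have "act (\<lambda>_. - 1, \<pi>) f = perm \<pi> (act (\<lambda>_. - 1, id) f)" for f :: "3 pol"
    proof (induction f rule: pol_var_induct)
      case (Var v)
      then show ?case by (cases v) (simp_all add: act_simps Const_one)
    qed (simp_all add: act_simps)
    moreover have "act (\<lambda>_. - 1, id) (centred c k) = - centred c k" if "c \<in> {X, Y}" for c and k :: 3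
      using that by (auto simp: centred_def act_diff act_sum act_simps act_numeral Const_minus_one sum_negf)
    moreover have "(- p) ^ m * (- q) ^ n = p ^ m * q ^ n" for p q :: "3 pol"
      using assms by (cases "even m") simp_all
    ultimately have "act (\<lambda>_. - 1, \<pi>) (power_sum m n) = perm \<pi> (power_sum m n :: 3 pol)"
      by (simp add: power_sum_def act_sum act_simps act_power act_uminus)
    then show ?thesis
      using that by (simp add: e perm_power_sum)
  qed
  then show ?thesis
    by (auto simp: invariants_def W_G2_def power_sum_in_S_A)
qed

text \<open>By symmetry each block has one diagonal and one off-diagonal value, and by translation
  invariance its rows sum to zero.\<close>

lemma S3_hessian:
  assumes "f \<in> invariants S_A W_A2" "c \<in> {X, Y}" "d \<in> {X, Y}"
  obtains a where "\<And>i j. const_term (pdiff (c i) (pdiff (d j) f)) = (if i = j then 2 * a else - a)"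
proof -
  let ?h = "\<lambda>i j. const_term (pdiff (c i) (pdiff (d j) f))"
  have h: "?h (\<pi> i) (\<pi> j) = ?h i j" if "bij \<pi>" for \<pi> i j
    using const_term_pdiff2_act[OF bij_is_inj[OF that] _ assms(2,3), of "\<lambda>_. 1" f i j] assms(1) that
    by (auto simp: invariants_def W_A2_def)
  note t = h[of "transpose _ _", simplified]
  have "?h 2 2 = ?h 1 1" "?h 3 3 = ?h 1 1" "?h 1 3 = ?h 1 2" "?h 2 1 = ?h 1 2" "?h 3 2 = ?h 1 2"
    "?h 2 3 = ?h 3 2" "?h 3 1 = ?h 2 1"
    using t[of 1 2 1 1] t[of 1 3 1 1] t[of 2 3 1 2] t[of 1 2 1 2] t[of 1 3 1 2] t[of 2 3 2 3] t[of 2 3 2 1]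
    by (simp_all add: transpose_def)
  moreover have "?h 1 1 + ?h 1 2 + ?h 1 3 = 0"
    using S_A_translation_invariant[of f d] assms(1,3)
    by (simp add: invariants_def pdiff_diff pdiff_uminus lookup_minus)
  ultimately have "?h i j = (if i = j then 2 * (- ?h 1 2) else - (- ?h 1 2))" for i j
    using three_cases[of i] three_cases[of j] by (auto simp: add_eq_0_iff2)
  then show ?thesis by (rule that)
qed

text \<open>The argument is that of \<open>R_B_bracket_pairing\<close>. The indices 2 and 3 serve as
  coordinates because translation invariance eliminates index 1.\<close>

lemma R_G_bracket_pairing:
  assumes "f \<in> invariants S_A W_A2" "g \<in> invariants S_A W_A2"
  shows "bracket_pairing 2 3 f g = 0"
proof -
  obtain a where a: "\<And>i j. const_term (pdiff (X i) (pdiff (X j) f)) = (if i = j then 2 * a else - a)"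
    by (rule S3_hessian[OF assms(1), of X X]) auto
  obtain b where b: "\<And>i j. const_term (pdiff (X i) (pdiff (Y j) f)) = (if i = j then 2 * b else - b)"
    by (rule S3_hessian[OF assms(1), of X Y]) auto
  obtain b' where b': "\<And>i j. const_term (pdiff (Y i) (pdiff (X j) f)) = (if i = j then 2 * b' else - b')"
    by (rule S3_hessian[OF assms(1), of Y X]) auto
  have [simp]: "b' = b"
    using b[of 1 2] b'[of 2 1] by (simp add: pdiff_commute)
  obtain c where c: "\<And>i j. const_term (pdiff (Y i) (pdiff (Y j) f)) = (if i = j then 2 * c else - c)"
    by (rule S3_hessian[OF assms(1), of Y Y]) auto
  have g: "g \<in> S_A" using assms(2) by (simp add: invariants_def)
  show ?thesis
    by (simp add: bracket_pairing_def nabla_pairing_def sum_UNIV_3 a b b' c S_A_translation_invariant[OF g]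
       pdiff_diff pdiff_uminus pdiff_add nabla_def lookup_add lookup_minus)
     (simp add: pdiff_commute algebra_simps)
qed

lemma not_ideal_R_G: "\<not> ideal (bracket_span R_G) (alg R_G)"
proof
  assume ideal: "ideal (bracket_span R_G) (alg R_G)"
  have bracket: "poisson (power_sum m n) (power_sum m' n') \<in> bracket_span R_G"
    if "even (m + n)" "even (m' + n')" for m n m' n'
    using that by (intro poisson_in_bracket_span power_sum_in_R_G)
  let ?h = "power_sum 2 0 * power_sum 0 2 - power_sum 1 1 ^ 2 :: 3 pol"
  have "?h \<in> bracket_span R_G"
  proof (rule ideal_bracket_span_disc[OF ideal])
    show "power_sum 2 0 \<in> bracket_span R_G"
      by (rule cancel_numeral_in_bracket_span[OF bracket power_sum_quadratic_brackets(1)]) auto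
    show "power_sum 1 1 \<in> bracket_span R_G"
      by (rule cancel_numeral_in_bracket_span[OF bracket power_sum_quadratic_brackets(2)]) auto
    show "power_sum 0 2 \<in> bracket_span R_G"
      by (rule cancel_numeral_in_bracket_span[OF bracket power_sum_quadratic_brackets(3)]) auto
  qed (simp_all add: power_sum_in_R_G)
  moreover have "f \<in> invariants S_A W_A2" "even_pol f" if "f \<in> R_G" for f
  proof -
    have "(\<lambda>_. - 1, id) \<in> W_G2"
      by (auto simp: W_G2_def)
    then show "f \<in> invariants S_A W_A2" "even_pol f"
      using that W_A2_subset by (auto simp: invariants_def)
  qed
  ultimately have "const_term (nabla 2 3 (nabla 2 3 ?h)) = 0"
    using const_term_nabla_nabla_bracket_span[of R_G 2 3] R_G_bracket_pairing by blast
  \<comment> \<open>\<open>?h\<close> is \<open>3 * disc ^ 2\<close>. Here \<open>nabla 2 3\<close>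
    takes \<open>disc ^ 2\<close> to \<open>18 * disc\<close> and \<open>disc\<close> to 6, so the
    value is 324.\<close>
  then show False
    by (simp add: nabla_def power2_eq_square pdiff_add pdiff_diff pdiff_uminus pdiff_mult pdiff_centred
        pdiff_power_sum_quadratic[unfolded One_nat_def] const_term_centred const_term_mult
        lookup_add lookup_minus)
qed

section \<open>Type \<open>A\<^sub>2\<close>\<close>

abbreviation R_A :: "3 pol set" where "R_A \<equiv> invariants S_A W_A2"

lemma Const_of_nat: "Const (of_nat n) = of_nat n"
  by (induction n) (simp_all add: Const_add Const_one, simp add: Const_def)

lemma scale_of_nat: "scale (of_nat n) f = of_nat n * f"
  by (simp add: scale_def Const_of_nat)

text \<open>As the centred coordinates sum to zero, any two indices give the same determinant up to
  sign. Transpositions negate it, so only its even powers are invariant.\<close>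

definition disc :: "3 pol" where
  "disc = centred X 1 * centred Y 2 - centred X 2 * centred Y 1"

lemma disc_in_S_A: "disc \<in> S_A"
  unfolding disc_def by (intro S_A_intros centred_in_S_A) auto

lemma pdiff_disc:
  "pdiff (X 1) disc = 2 * centred Y 2 + centred Y 1"
  "pdiff (X 2) disc = - centred Y 2 - 2 * centred Y 1"
  "pdiff (X 3) disc = - centred Y 2 + centred Y 1"
  "pdiff (Y 1) disc = - centred X 1 - 2 * centred X 2"
  "pdiff (Y 2) disc = 2 * centred X 1 + centred X 2"
  "pdiff (Y 3) disc = - centred X 1 + centred X 2"
  by (simp_all add: disc_def pdiff_diff pdiff_mult pdiff_centred)

lemma poisson_power: "poisson f (g ^ n) = of_nat n * g ^ (n - 1) * poisson f g"
  by (simp add: poisson_def pdiff_power sum_distrib_left algebra_simps)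

lemma pdiff_power_sum:
  "pdiff (X k) (power_sum m n :: 3 pol) =
    of_nat m * (3 * centred X k ^ (m - 1) * centred Y k ^ n - power_sum (m - 1) n)"
  "pdiff (Y k) (power_sum m n :: 3 pol) =
    of_nat n * (3 * centred X k ^ m * centred Y k ^ (n - 1) - power_sum m (n - 1))"
  using three_cases[of k]
  by (elim disjE; simp add: power_sum_def sum_UNIV_3 pdiff_add pdiff_mult pdiff_power pdiff_centred
      algebra_simps)+

text \<open>The coefficients 1, -3, 3, -1 are those of the invariant pairing of binary cubics. This
  is the part of the contraction in which a cubic is differentiated.\<close>

lemma cubic_brackets:
  "poisson (power_sum 3 0) (power_sum 0 3) - 3 * poisson (power_sum 2 1) (power_sum 1 2) +
   3 * poisson (power_sum 1 2) (power_sum 2 1) - poisson (power_sum 0 3) (power_sum 3 0) = - 216 * disc ^ 2"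
  unfolding power_sum_bracket[OF power_sum_in_S_A] pdiff_power_sum
  unfolding power_sum_def disc_def
  by (simp add: sum_UNIV_3 centred_three)
     (simp add: algebra_simps power2_eq_square power3_eq_cube)

text \<open>The complementary part, in which the power of \<open>disc\<close> is
  differentiated.\<close>

lemma cubic_disc_brackets:
  "power_sum 0 3 * poisson (power_sum 3 0) disc - 3 * power_sum 1 2 * poisson (power_sum 2 1) disc +
   3 * power_sum 2 1 * poisson (power_sum 1 2) disc - power_sum 3 0 * poisson (power_sum 0 3) disc =
   - 54 * disc ^ 3"
  unfolding power_sum_bracket[OF disc_in_S_A]
  by (simp add: sum_UNIV_3 pdiff_disc, simp only: power_sum_def disc_def,
      simp add: sum_UNIV_3 centred_three)
     (simp add: algebra_simps power2_eq_square power3_eq_cube)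

text \<open>
  The four brackets are the contraction of the binary cubics \<^term>\<open>power_sum i (3 - i)\<close> with themselves,
  so that the outcome is \<open>sl\<^sub>2\<close>-invariant and must be a multiple of a power of \<^const>\<open>disc\<close>.
\<close>
lemma cubic_bracket_disc_power:
  fixes n :: nat
  shows "poisson (power_sum 3 0) (power_sum 0 3 * disc ^ n) -
   3 * poisson (power_sum 2 1) (power_sum 1 2 * disc ^ n) +
   3 * poisson (power_sum 1 2) (power_sum 2 1 * disc ^ n) - poisson (power_sum 0 3) (power_sum 3 0 * disc ^ n) =
   scale (- of_nat (216 + 54 * n)) (disc ^ (n + 2))"
  (is "?L = ?R")
proof -
  have "?L = (- 216 * disc ^ 2) * disc ^ n + of_nat n * disc ^ (n - 1) * (- 54 * disc ^ 3)"
    unfolding cubic_brackets[symmetric] cubic_disc_brackets[symmetric] poisson_mult poisson_power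
    by (simp add: algebra_simps)
  \<comment> \<open>For \<open>n = 0\<close> the exponent \<open>n - 1\<close> is truncated, but the
    factor \<open>of_nat n\<close> kills the term.\<close>
  also have "of_nat n * disc ^ (n - 1) * (- 54 * disc ^ 3) = - (of_nat n * (54 * disc ^ (n + 2)))"
    by (cases n) (simp_all add: power_add power3_eq_cube power2_eq_square algebra_simps)
  also have "- 216 * disc ^ 2 * disc ^ n + - (of_nat n * (54 * disc ^ (n + 2))) = ?R"
    unfolding scale_simps scale_of_nat by (simp add: power2_eq_square algebra_simps)
  finally show ?thesis .
qed

lemma lagrange: "power_sum 2 0 * power_sum 0 2 - power_sum 1 1 ^ 2 = 3 * disc ^ 2"
  by (simp add: power_sum_def disc_def sum_UNIV_3 centred_three)
     (simp add: algebra_simps power2_eq_square)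

subsection \<open>Reduction modulo the action of \<open>sl\<^sub>2\<close>\<close>

lemma polar_eq:
  assumes "f \<in> S_A" "d \<in> {X, Y}"
  shows "polar c d f = (centred c 2 - centred c 1) * pdiff (d 2) f +
    (- centred c 2 - 2 * centred c 1) * pdiff (d 3) f"
  by (simp add: polar_def sum_UNIV_3 S_A_translation_invariant[OF assms] centred_three algebra_simps)

lemma polar_in_S_A: "f \<in> S_A \<Longrightarrow> c \<in> {X, Y} \<Longrightarrow> polar c d f \<in> S_A"
  unfolding polar_def by (intro S_A_sum S_A_intros S_A_pdiff centred_in_S_A)

text \<open>
  This is the Capelli identity of the two-dimensional reflection representation: \<^term>\<open>nabla 2 3\<close> is
  the operator dual to \<^term>\<open>disc\<close>, and the factors \<open>3\<close> come from \<^const>\<open>centred\<close>, which is three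
  times the projection to sum zero.
\<close>
lemma capelli:
  assumes "f \<in> S_A"
  shows "3 * disc * nabla 2 3 f = polar X X (polar Y Y f) + 3 * polar Y Y f - polar Y X (polar X Y f)"
proof -
  have "polar X X (polar Y Y f) = (centred X 2 - centred X 1) * pdiff (X 2) (polar Y Y f) +
      (- centred X 2 - 2 * centred X 1) * pdiff (X 3) (polar Y Y f)"
    "polar Y X (polar X Y f) = (centred Y 2 - centred Y 1) * pdiff (X 2) (polar X Y f) +
      (- centred Y 2 - 2 * centred Y 1) * pdiff (X 3) (polar X Y f)"
    using assms by (auto intro!: polar_eq polar_in_S_A)
  then show ?thesis
    by (simp add: polar_eq[OF assms] pdiff_add pdiff_diff pdiff_mult pdiff_uminus pdiff_centred
        nabla_def disc_def pdiff_commute)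
       (simp add: algebra_simps)
qed

lemma polar_add: "polar c d (f + g) = polar c d f + polar c d g"
  by (simp add: polar_def pdiff_add algebra_simps sum.distrib)

lemma polar_mult: "polar c d (f * g) = polar c d f * g + f * polar c d g"
  by (simp add: polar_def pdiff_mult algebra_simps sum.distrib sum_distrib_left sum_distrib_right)

lemma polar_diff: "polar c d (f - g) = polar c d f - polar c d g"
  by (simp add: polar_def pdiff_diff algebra_simps sum_subtractf)

lemma polar_Const: "polar c d (Const a) = 0"
  by (simp add: polar_def)

lemma polar_of_nat_mult: "polar c d (of_nat n * f) = of_nat n * polar c d f"
  using polar_Const[of c d "of_nat n"] by (simp add: polar_mult Const_of_nat)

text \<open>Generated from linear forms inside \<open>S_A\<close>, so that Euler's identity follows
  by rule induction. Zero is homogeneous of every degree.\<close>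

inductive homogeneous :: "nat \<Rightarrow> 3 pol \<Rightarrow> bool" where
  const: "homogeneous 0 (Const a)"
| mult: "homogeneous d f \<Longrightarrow> c \<in> {X, Y} \<Longrightarrow> homogeneous (Suc d) ((Var (c i) - Var (c j)) * f)"
| add: "homogeneous d f \<Longrightarrow> homogeneous d g \<Longrightarrow> homogeneous d (f + g)"

lemma homogeneous_S_A: "homogeneous d f \<Longrightarrow> f \<in> S_A"
  by (induction rule: homogeneous.induct) (auto intro: S_A_intros Var_diff_in_S_A)

lemma homogeneous_zero: "homogeneous d 0"
proof (induction d)
  case 0
  show ?case using homogeneous.const[of 0] by (simp add: Const_def)
next
  case (Suc d)
  then show ?case using homogeneous.mult[OF Suc, of X 1 1] by simp
qed

lemma homogeneous_scale: "homogeneous d f \<Longrightarrow> homogeneous d (scale a f)"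
proof (induction rule: homogeneous.induct)
  case (const b)
  then show ?case by (simp add: scale_def Const_mult[symmetric] homogeneous.const)
next
  case (mult d f c i j)
  then show ?case using homogeneous.mult[of d "scale a f" c i j] by (simp add: scale_def mult.left_commute)
qed (simp add: pol.scale_right_distrib homogeneous.add)

lemma homogeneous_uminus: "homogeneous d f \<Longrightarrow> homogeneous d (- f)"
  using homogeneous_scale[of d f "- 1"] by simp

lemma homogeneous_diff: "homogeneous d f \<Longrightarrow> homogeneous d g \<Longrightarrow> homogeneous d (f - g)"
  using homogeneous.add[OF _ homogeneous_uminus, of d f g] by simp

lemma homogeneous_sum: "(\<And>i. i \<in> A \<Longrightarrow> homogeneous d (f i)) \<Longrightarrow> homogeneous d (\<Sum>i\<in>A. f i)"
  by (induction A rule: infinite_finite_induct) (auto intro: homogeneous_zero homogeneous.add)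

lemma homogeneous_mult:
  "homogeneous d f \<Longrightarrow> homogeneous e g \<Longrightarrow> homogeneous (d + e) (f * g)"
proof (induction rule: homogeneous.induct)
  case (const a)
  then show ?case using homogeneous_scale by (auto simp: scale_def)
next
  case (mult d f c i j)
  then show ?case using homogeneous.mult[of "d + e" "f * g" c i j] by (simp add: mult.assoc)
qed (simp add: distrib_right homogeneous.add)

lemma homogeneous_centred: "c \<in> {X, Y} \<Longrightarrow> homogeneous 1 (centred c k)"
proof -
  assume c: "c \<in> {X, Y}"
  have "centred c k = (\<Sum>i\<in>UNIV. (Var (c k) - Var (c i)) * Const 1)"
    by (simp add: centred_def sum_subtractf Const_one)
  moreover have "homogeneous 1 ((Var (c k) - Var (c i)) * Const 1)" for i
    using homogeneous.mult[OF homogeneous.const c] by simp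
  ultimately show ?thesis
    by (simp only: homogeneous_sum)
qed

text \<open>The second conjunct compensates for the truncation of \<open>d - 1\<close> at
  \<open>d = 0\<close>.\<close>

lemma homogeneous_pdiff:
  "homogeneous d f \<Longrightarrow> homogeneous (d - 1) (pdiff v f) \<and> (d = 0 \<longrightarrow> pdiff v f = 0)"
proof (induction rule: homogeneous.induct)
  case (mult d f c i j)
  have "pdiff v (Var (c i) - Var (c j)) \<in> {0, 1, - 1}"
    by (auto simp: pdiff_diff pdiff_Var)
  with mult have "homogeneous d (pdiff v (Var (c i) - Var (c j)) * f)"
    by (auto intro: homogeneous_zero homogeneous_uminus)
  moreover have "homogeneous d ((Var (c i) - Var (c j)) * pdiff v f)"
    using mult homogeneous.mult[of "d - 1" "pdiff v f" c i j] by (cases d) (auto intro: homogeneous_zero)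
  ultimately show ?case
    by (simp add: pdiff_mult homogeneous.add)
qed (auto simp: pdiff_add intro: homogeneous_zero homogeneous.add)

lemma homogeneous_polar:
  assumes "homogeneous d f" "c \<in> {X, Y}"
  shows "homogeneous d (polar c e f)"
proof (cases d)
  case 0
  then show ?thesis
    using homogeneous_pdiff[OF assms(1)] by (simp add: polar_def homogeneous_zero)
next
  case (Suc n)
  then show ?thesis
    using homogeneous_mult[OF homogeneous_centred[OF assms(2)], of "d - 1"] homogeneous_pdiff[OF assms(1)]
    by (auto simp: polar_def intro!: homogeneous_sum)
qed

lemma polar_linear:
  "polar X X (Var (X i) - Var (X j)) = 3 * (Var (X i) - Var (X j))" "polar X X (Var (Y i) - Var (Y j)) = 0"
  "polar Y Y (Var (Y i) - Var (Y j)) = 3 * (Var (Y i) - Var (Y j))" "polar Y Y (Var (X i) - Var (X j)) = 0"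
proof -
  have "polar c X (Var (X l)) = centred c l" "polar c Y (Var (Y l)) = centred c l"
    "polar c X (Var (Y l)) = 0" "polar c Y (Var (X l)) = 0" for c l
    using three_cases[of l] by (auto simp: polar_def sum_UNIV_3 pdiff_Var)
  then show "polar X X (Var (X i) - Var (X j)) = 3 * (Var (X i) - Var (X j))" "polar X X (Var (Y i) - Var (Y j)) = 0"
    "polar Y Y (Var (Y i) - Var (Y j)) = 3 * (Var (Y i) - Var (Y j))" "polar Y Y (Var (X i) - Var (X j)) = 0"
    by (simp_all add: polar_diff centred_def)
qed

lemma euler:
  "homogeneous d f \<Longrightarrow> polar X X f + polar Y Y f = of_nat (3 * d) * f"
proof (induction rule: homogeneous.induct)
  case (const a)
  then show ?case by (simp add: polar_Const)
next
  case (mult d f c i j)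
  define g where "g = Var (c i) - Var (c j)"
  have "polar X X g + polar Y Y g = 3 * g"
    using mult.hyps(2) by (auto simp: g_def polar_linear)
  moreover have "polar X X (g * f) + polar Y Y (g * f) =
      (polar X X g + polar Y Y g) * f + g * (polar X X f + polar Y Y f)"
    by (simp add: polar_mult algebra_simps)
  ultimately show ?case
    unfolding g_def[symmetric] by (simp add: mult.IH algebra_simps)
next
  case (add d f g)
  have "polar X X (f + g) + polar Y Y (f + g) = (polar X X f + polar Y Y f) + (polar X X g + polar Y Y g)"
    by (simp add: polar_add)
  then show ?case by (simp only: add.IH distrib_left)
qed

text \<open>On degree \<open>d\<close> the two diagonal polarizations add up to
  \<open>3 * d\<close>, so both are expressed by \<open>H\<close>, and four times the Capelli
  identity becomes this. All terms on the right except the first lie in the image of sl_2.\<close>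

lemma capelli_homogeneous:
  assumes "homogeneous d f"
  defines "H \<equiv> \<lambda>g. polar X X g - polar Y Y g"
  shows "of_nat (9 * d * (d + 2)) * f =
    12 * (disc * nabla 2 3 f) + H (H f) + 6 * H f + 4 * polar Y X (polar X Y f)"
proof -
  let ?A = "polar X X" and ?B = "polar Y Y" and ?n = "of_nat (3 * d) :: 3 pol"
  have Hf: "homogeneous d (H f)"
    unfolding H_def using assms(1) by (intro homogeneous_diff homogeneous_polar) auto
  have B: "?B g = ?n * g - ?A g" if "homogeneous d g" for g
    using euler[OF that] by (simp add: algebra_simps)
  have H: "H g = 2 * ?A g - ?n * g" if "homogeneous d g" for g
    using B[OF that] by (simp add: H_def)
  have A_n: "?A (?n * g) = ?n * ?A g" for g
    by (rule polar_of_nat_mult)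
  have A_2: "?A (2 * g) = 2 * ?A g" for g
    using polar_of_nat_mult[of X X 2 g] by simp
  have "12 * (disc * nabla 2 3 f) = 4 * (3 * disc * nabla 2 3 f)"
    by simp
  also have "\<dots> = 4 * (?A (?B f) + 3 * ?B f) - 4 * polar Y X (polar X Y f)"
    by (simp add: capelli homogeneous_S_A[OF assms(1)])
  also have "4 * (?A (?B f) + 3 * ?B f) = (?n * ?n + 6 * ?n) * f - H (H f) - 6 * H f"
    unfolding H[OF Hf] unfolding H[OF assms(1)] B[OF assms(1)] polar_diff A_n A_2
    by (simp add: algebra_simps)
  finally show ?thesis
    by (simp add: algebra_simps)
qed

definition sl2_span :: "3 pol set" where
  "sl2_span = pol.span (range (\<lambda>k. disc ^ k) \<union>
     (polar X Y ` S_A \<union> polar Y X ` S_A \<union> (\<lambda>g. polar X X g - polar Y Y g) ` S_A))"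

lemma subspace_sl2_span: "pol.subspace sl2_span"
  by (simp add: sl2_span_def pol.subspace_span)

lemma sl2_span_base:
  "disc ^ k \<in> sl2_span"
  "g \<in> S_A \<Longrightarrow> polar X Y g \<in> sl2_span" "g \<in> S_A \<Longrightarrow> polar Y X g \<in> sl2_span"
  "g \<in> S_A \<Longrightarrow> polar X X g - polar Y Y g \<in> sl2_span"
  unfolding sl2_span_def by (rule pol.span_base; blast)+

lemma mult_scale_right: "f * scale c g = scale c (f * g)"
  by (simp add: scale_def mult.left_commute)

lemma sl2_span_numeral: "f \<in> sl2_span \<Longrightarrow> numeral n * f \<in> sl2_span"
  using pol.subspace_scale[OF subspace_sl2_span, of f "numeral n"] by (simp add: scale_simps)

lemma polar_disc:
  "polar X Y disc = 0" "polar Y X disc = 0" "polar X X disc = 3 * disc" "polar Y Y disc = 3 * disc"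
  by (simp_all add: polar_def sum_UNIV_3 pdiff_disc centred_three)
     (simp_all add: disc_def algebra_simps)

text \<open>The operators of sl_2 are derivations that kill \<open>disc\<close>, hence they commute
  with multiplication by it.\<close>

lemma disc_mult_sl2_span:
  assumes "f \<in> sl2_span"
  shows "disc * f \<in> sl2_span"
proof -
  let ?G = "range (\<lambda>k. disc ^ k) \<union>
     (polar X Y ` S_A \<union> polar Y X ` S_A \<union> (\<lambda>g. polar X X g - polar Y Y g) ` S_A)"
  have "pol.span ?G \<subseteq> {f. disc * f \<in> sl2_span}"
  proof (rule pol.span_minimal)
    show "pol.subspace {f. disc * f \<in> sl2_span}"
      using pol.subspace_add[OF subspace_sl2_span] pol.subspace_scale[OF subspace_sl2_span]
        pol.subspace_0[OF subspace_sl2_span]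
      by (intro pol.subspaceI) (auto simp: distrib_left mult_scale_right)
    have "disc * polar X Y g = polar X Y (disc * g)" "disc * polar Y X g = polar Y X (disc * g)"
      "disc * (polar X X g - polar Y Y g) = polar X X (disc * g) - polar Y Y (disc * g)" for g
      by (simp_all add: polar_mult polar_disc algebra_simps)
    moreover have "disc * disc ^ k \<in> sl2_span" for k
      using sl2_span_base(1)[of "Suc k"] by simp
    ultimately show "?G \<subseteq> {f. disc * f \<in> sl2_span}"
      using S_A_intros(3)[OF disc_in_S_A] sl2_span_base by auto
  qed
  with assms show ?thesis
    unfolding sl2_span_def[symmetric] by blast
qed

lemma homogeneous_0_const: "homogeneous d f \<Longrightarrow> d = 0 \<Longrightarrow> \<exists>a. f = Const a"
  by (induction rule: homogeneous.induct) (auto simp: Const_add[symmetric])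

lemma homogeneous_in_sl2_span: "homogeneous d f \<Longrightarrow> f \<in> sl2_span"
proof (induction d arbitrary: f rule: less_induct)
  case (less d)
  show ?case
  proof (cases "d = 0")
    case True
    then obtain a where "f = Const a" using homogeneous_0_const[OF less.prems] by blast
    then show ?thesis
      using pol.subspace_scale[OF subspace_sl2_span sl2_span_base(1)[of 0], of a] by (simp add: scale_def)
  next
    case False
    \<comment> \<open>For \<open>d = 1\<close> this truncates to degree 0, which is still below
      \<open>d\<close>.\<close>
    have "homogeneous (d - 1 - 1) (nabla 2 3 f)"
      unfolding nabla_def using homogeneous_pdiff less.prems by (blast intro: homogeneous_diff)
    then have "nabla 2 3 f \<in> sl2_span"
      using less.IH[of "d - 1 - 1"] False by simp
    note disc = disc_mult_sl2_span[OF this]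
    have f: "f \<in> S_A" by (rule homogeneous_S_A[OF less.prems])
    let ?H = "\<lambda>g. polar X X g - polar Y Y g"
    have H: "?H f \<in> S_A"
      using f by (intro S_A_intros polar_in_S_A) auto
    have "of_nat (9 * d * (d + 2)) * f \<in> sl2_span"
      unfolding capelli_homogeneous[OF less.prems]
      by (intro pol.subspace_add[OF subspace_sl2_span] sl2_span_numeral disc sl2_span_base H f polar_in_S_A)
         auto
    then have "scale (1 / of_nat (9 * d * (d + 2))) (scale (of_nat (9 * d * (d + 2))) f) \<in> sl2_span"
      unfolding scale_of_nat by (rule pol.subspace_scale[OF subspace_sl2_span])
    moreover have "(of_nat (9 * d * (d + 2)) :: complex) \<noteq> 0"
      using False by (simp only: of_nat_eq_0_iff) simp
    ultimately show ?thesis by (simp del: of_nat_mult of_nat_add)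
  qed
qed

lemma S_A_subset_span_homogeneous:
  assumes "f \<in> S_A"
  shows "f \<in> pol.span {g. \<exists>d. homogeneous d g}"
  using assms
proof (induction f rule: S_A_induct)
  case (Const c)
  then show ?case by (intro pol.span_base) (auto intro: homogeneous.const)
next
  case (diff c k)
  then show ?case
    using homogeneous.mult[OF homogeneous.const[of 1], of c 1 k] by (intro pol.span_base) (auto simp: Const_one)
next
  case (add f g)
  then show ?case by (intro pol.span_add)
next
  case (mult f g)
  let ?S = "pol.span {g. \<exists>d. homogeneous d g}"
  have sub: "pol.subspace {f. f * g \<in> ?S}" for g
    using pol.span_zero pol.span_add pol.span_scale[of _ "{g. \<exists>d. homogeneous d g}"]
    by (intro pol.subspaceI) (auto simp: scale_def distrib_right mult.assoc)
  \<comment> \<open>Bilinearity in two rounds: first one factor is still homogeneous, then both are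
    arbitrary.\<close>
  have *: "h * f \<in> ?S" if h: "homogeneous d h" for h d
  proof -
    have "{g. \<exists>d. homogeneous d g} \<subseteq> {f. f * h \<in> ?S}"
      using homogeneous_mult[OF _ h] by (auto intro!: pol.span_base)
    from pol.span_minimal[OF this sub] mult.IH(1) show ?thesis
      by (auto simp: mult.commute)
  qed
  then have "{g. \<exists>d. homogeneous d g} \<subseteq> {g. g * f \<in> ?S}"
    by auto
  from pol.span_minimal[OF this sub] mult.IH(2) show ?case
    by (auto simp: mult.commute)
qed

lemma S_A_subset_sl2_span: "S_A \<subseteq> sl2_span"
proof
  fix f :: "3 pol"
  assume "f \<in> S_A"
  then have "f \<in> pol.span {g. \<exists>d. homogeneous d g}"
    by (rule S_A_subset_span_homogeneous)
  moreover have "pol.span {g. \<exists>d. homogeneous d g} \<subseteq> sl2_span"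
    using subspace_sl2_span homogeneous_in_sl2_span by (intro pol.span_minimal) auto
  ultimately show "f \<in> sl2_span" by blast
qed

lemma subspace_invariants: "pol.subspace S \<Longrightarrow> pol.subspace (invariants S W)"
  by (rule pol.subspaceI)
    (auto simp: invariants_def pol.subspace_0 pol.subspace_add pol.subspace_scale act_simps act_scale)

lemma R_A_iff: "f \<in> R_A \<longleftrightarrow> f \<in> S_A \<and> (\<forall>\<pi>. bij \<pi> \<longrightarrow> perm \<pi> f = f)"
  by (auto simp: invariants_def W_A2_def)

lemma R_A_mult: "f \<in> R_A \<Longrightarrow> g \<in> R_A \<Longrightarrow> f * g \<in> R_A"
  by (simp add: R_A_iff S_A_intros act_simps)

lemma R_A_power: "f \<in> R_A \<Longrightarrow> f ^ n \<in> R_A"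
  by (simp add: R_A_iff S_A_power act_power)

lemma power_sum_in_R_A: "power_sum m n \<in> R_A"
  by (simp add: R_A_iff power_sum_in_S_A perm_power_sum)

lemma poisson_in_R_A: "f \<in> R_A \<Longrightarrow> g \<in> R_A \<Longrightarrow> poisson f g \<in> R_A"
  using poisson_act[of _ "\<lambda>_. 1" f g] by (auto simp: R_A_iff S_A_poisson)

text \<open>Lagrange's identity exhibits it through invariants, without computing any permutation of
  \<open>disc\<close>.\<close>

lemma disc_square_in_R_A: "disc ^ 2 \<in> R_A"
proof (rule scale_numeral_cancel)
  show sub: "pol.subspace R_A"
    by (intro subspace_invariants S_A_subspace)
  show "3 * disc ^ 2 \<in> R_A"
    unfolding lagrange[symmetric]
    by (intro pol.subspace_diff sub R_A_mult R_A_power power_sum_in_R_A)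
qed

text \<open>For even \<open>n\<close> the factor \<open>disc ^ n\<close> is invariant, so
  \<open>cubic_bracket_disc_power\<close> involves brackets of invariants only. Its scalar never
  vanishes, because both contributions have the same sign.\<close>

lemma disc_power_in_bracket_span:
  assumes "even n"
  shows "disc ^ (n + 2) \<in> bracket_span R_A"
proof -
  have "disc ^ n \<in> R_A"
    using assms R_A_power[OF disc_square_in_R_A, of "n div 2"] by (simp add: power_mult[symmetric])
  then have b: "poisson (power_sum i j) (power_sum k l * disc ^ n) \<in> bracket_span R_A" for i j k l
    by (intro poisson_in_bracket_span R_A_mult power_sum_in_R_A)
  have b3: "3 * poisson (power_sum i j) (power_sum k l * disc ^ n) \<in> bracket_span R_A" for i j k l
    using bracket_span_scale[OF b, of 3] by (simp add: scale_simps)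
  have "scale (- of_nat (216 + 54 * n)) (disc ^ (n + 2)) \<in> bracket_span R_A"
    unfolding cubic_bracket_disc_power[symmetric]
    by (intro bracket_span_add bracket_span_diff b b3)
  then have "scale (1 / - of_nat (216 + 54 * n)) (scale (- of_nat (216 + 54 * n)) (disc ^ (n + 2)))
      \<in> bracket_span R_A"
    by (rule bracket_span_scale)
  moreover have "(- of_nat (216 + 54 * n) :: complex) \<noteq> 0"
    by (simp only: neg_equal_0_iff_equal of_nat_eq_0_iff)
  ultimately show ?thesis
    by (simp only: pol.scale_scale) simp
qed

subsection \<open>Symmetrization\<close>

text \<open>The Reynolds operator without its normalization; on invariants it multiplies by the
  group order.\<close>

definition symmetrization :: "'i::finite pol \<Rightarrow> 'i pol" where
  "symmetrization f = (\<Sum>\<pi> | bij \<pi>. perm \<pi> f)"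

lemma perm_perm: "perm \<rho> (perm \<pi> f) = perm (\<rho> \<circ> \<pi>) f"
proof (induction f rule: pol_var_induct)
  case (Var v)
  then show ?case by (cases v) (simp_all add: act_simps Const_one)
qed (simp_all add: act_simps)

lemma bij_betw_comp_bij:
  assumes "bij \<rho>"
  shows "bij_betw (\<lambda>\<pi>. \<rho> \<circ> \<pi>) {\<pi>. bij \<pi>} {\<pi>. bij \<pi>}"
    and "bij_betw (\<lambda>\<pi>. \<pi> \<circ> \<rho>) {\<pi>. bij \<pi>} {\<pi>. bij \<pi>}"
proof -
  define \<sigma> where "\<sigma> = inv_into UNIV \<rho>"
  have inv: "bij \<sigma>" "\<sigma> \<circ> \<rho> = id" "\<rho> \<circ> \<sigma> = id"
    using assms by (auto simp: \<sigma>_def bij_imp_bij_inv bij_is_inj bij_is_surj surj_iff[symmetric])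
  show "bij_betw (\<lambda>\<pi>. \<rho> \<circ> \<pi>) {\<pi>. bij \<pi>} {\<pi>. bij \<pi>}"
    by (rule bij_betw_byWitness[where f' = "\<lambda>\<pi>. \<sigma> \<circ> \<pi>"])
      (auto simp: comp_assoc[symmetric] inv intro: bij_comp assms)
  show "bij_betw (\<lambda>\<pi>. \<pi> \<circ> \<rho>) {\<pi>. bij \<pi>} {\<pi>. bij \<pi>}"
    by (rule bij_betw_byWitness[where f' = "\<lambda>\<pi>. \<pi> \<circ> \<sigma>"])
      (auto simp: comp_assoc inv intro: bij_comp assms)
qed

lemma perm_symmetrization:
  assumes "bij \<rho>"
  shows "perm \<rho> (symmetrization f) = symmetrization f"
    and "symmetrization (perm \<rho> f) = symmetrization f"
  using sum.reindex_bij_betw[OF bij_betw_comp_bij(1)[OF assms], of "\<lambda>\<pi>. perm \<pi> f"]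
    sum.reindex_bij_betw[OF bij_betw_comp_bij(2)[OF assms], of "\<lambda>\<pi>. perm \<pi> f"]
  by (simp_all add: symmetrization_def act_sum perm_perm)

lemma symmetrization_linear:
  "symmetrization (f + g) = symmetrization f + symmetrization g"
  "symmetrization (scale c f) = scale c (symmetrization f)"
  "symmetrization 0 = 0" "symmetrization (- f) = - symmetrization f"
  "symmetrization (numeral n * f) = numeral n * symmetrization f"
  by (simp_all add: symmetrization_def act_simps act_scale act_uminus act_numeral sum.distrib
      pol.scale_sum_right sum_negf sum_distrib_left)

lemma symmetrization_in_R_A: "f \<in> S_A \<Longrightarrow> symmetrization f \<in> R_A"
  by (auto simp: R_A_iff perm_symmetrization) (auto simp: symmetrization_def intro!: S_A_sum S_A_perm)

lemma symmetrization_R_A: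
  "f \<in> R_A \<Longrightarrow> symmetrization f = scale (of_nat (card {\<pi> :: 3 \<Rightarrow> 3. bij \<pi>})) f"
  by (simp add: symmetrization_def R_A_iff scale_of_nat)

text \<open>With a quadratic invariant as \<open>f\<close>, this turns the image of sl_2 into
  brackets of invariants.\<close>

lemma symmetrization_poisson:
  "f \<in> R_A \<Longrightarrow> symmetrization (poisson f g) = poisson f (symmetrization g)"
proof -
  assume f: "f \<in> R_A"
  have "perm \<pi> (poisson f g) = poisson f (perm \<pi> g)" if "bij \<pi>" for \<pi>
    using f poisson_act[OF that, of "\<lambda>_. 1" f g] that by (simp add: R_A_iff)
  then show ?thesis
    by (simp add: symmetrization_def poisson_sum_right)
qed

text \<open>The condition is linear, so generators suffice. The power 0 of \<open>disc\<close> gives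
  the constant, positive even powers are brackets, odd powers are negated by a transposition and
  symmetrize to 0, and the image of sl_2 goes to brackets.\<close>

lemma symmetrization_sl2_span:
  assumes "f \<in> sl2_span"
  shows "\<exists>c. symmetrization f - Const c \<in> bracket_span R_A"
proof -
  let ?V = "{f. \<exists>c. symmetrization f - Const c \<in> bracket_span R_A}"
  let ?N = "card {\<pi> :: 3 \<Rightarrow> 3. bij \<pi>}"
  have sub: "pol.subspace ?V"
  proof (rule pol.subspaceI)
    show "0 \<in> ?V"
      by (auto simp: symmetrization_linear bracket_span_zero intro!: exI[of _ 0])
         (simp add: Const_def bracket_span_zero)
  next
    fix f g assume "f \<in> ?V" "g \<in> ?V"
    then obtain a b where "symmetrization f - Const a \<in> bracket_span R_A"
      "symmetrization g - Const b \<in> bracket_span R_A"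
      by blast
    from bracket_span_add[OF this] show "f + g \<in> ?V"
      by (auto simp: symmetrization_linear Const_add algebra_simps intro!: exI[of _ "a + b"])
  next
    fix c f assume "f \<in> ?V"
    then obtain a where "symmetrization f - Const a \<in> bracket_span R_A"
      by blast
    from bracket_span_scale[OF this, of c] show "scale c f \<in> ?V"
      by (auto simp: symmetrization_linear pol.scale_right_diff_distrib intro!: exI[of _ "c * a"])
         (simp add: scale_def Const_mult)
  qed
  have bracket: "f \<in> ?V" if "symmetrization f \<in> bracket_span R_A" for f
    using that by (auto intro!: exI[of _ 0] simp: Const_def)
  have power: "disc ^ k \<in> ?V" for k
  proof (cases "even k")
    case True
    show ?thesis
    proof (cases "k = 0")
      case True
      have "symmetrization 1 = (Const (of_nat ?N) :: 3 pol)"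
        by (simp add: symmetrization_def act_simps Const_of_nat)
      then show ?thesis
        using True bracket_span_zero[of R_A] by (auto intro!: exI[of _ "of_nat ?N"])
    next
      case False
      with True obtain n where n: "k = n + 2" "even n"
        by (metis One_nat_def Suc_1 Suc_leI add.commute even_add even_numeral le_add_diff_inverse
            neq0_conv odd_one order_neq_le_trans)
      have "disc ^ k \<in> R_A"
        using True R_A_power[OF disc_square_in_R_A, of "k div 2"] by (simp add: power_mult[symmetric])
      then show ?thesis
        using bracket_span_scale[OF disc_power_in_bracket_span[OF n(2)]] n(1)
        by (intro bracket) (simp add: symmetrization_R_A)
    qed
  next
    case False
    have "perm (transpose 1 2) disc = - disc"
      by (simp add: disc_def act_diff act_simps perm_centred)
    then have "symmetrization (disc ^ k) = - symmetrization (disc ^ k)"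
      using perm_symmetrization(2)[of "transpose 1 2" "disc ^ k"] False
      by (simp add: act_power symmetrization_linear)
    then have "2 * symmetrization (disc ^ k) = 0"
      by (metis add.right_inverse mult_2)
    then have "scale (1 / 2) (scale 2 (symmetrization (disc ^ k))) = 0"
      by (simp only: scale_simps) simp
    then show ?thesis
      using bracket_span_zero[of R_A] by (intro bracket) simp
  qed
  have poisson: "symmetrization (poisson (power_sum m n) g) \<in> bracket_span R_A" if "g \<in> S_A" for m n g
    using that
    by (simp add: symmetrization_poisson power_sum_in_R_A symmetrization_in_R_A poisson_in_bracket_span)
  have "polar X Y g \<in> ?V" "polar Y X g \<in> ?V" "polar X X g - polar Y Y g \<in> ?V" if g: "g \<in> S_A" for g
  proof -
    have V: "poisson (power_sum m n) g \<in> ?V" for m n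
      by (rule bracket[OF poisson[OF g]])
    show "polar X Y g \<in> ?V"
      using scale_numeral_cancel[OF sub] V[of 2 0] by (simp only: power_sum_quadratic_bracket[OF g])
    have "6 * polar Y X g \<in> ?V"
      using pol.subspace_neg[OF sub V[of 0 2]] by (simp only: power_sum_quadratic_bracket[OF g]) simp
    then show "polar Y X g \<in> ?V"
      by (rule scale_numeral_cancel[OF sub])
    have "3 * (polar X X g - polar Y Y g) \<in> ?V"
      using pol.subspace_neg[OF sub V[of 1 1]] unfolding power_sum_quadratic_bracket[OF g]
      by (simp only: mult_minus_right[symmetric] minus_diff_eq)
    then show "polar X X g - polar Y Y g \<in> ?V"
      by (rule scale_numeral_cancel[OF sub])
  qed
  with power have "sl2_span \<subseteq> ?V"
    unfolding sl2_span_def by (intro pol.span_minimal[OF _ sub]) auto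
  with assms show ?thesis by blast
qed

section \<open>Brackets and the augmentation ideal in type A_2\<close>

lemma R_A_const_term_pdiff:
  assumes "f \<in> R_A" "c \<in> {X, Y}"
  shows "const_term (pdiff (c i) f) = 0"
proof -
  have sym: "const_term (pdiff (c (\<pi> i)) f) = const_term (pdiff (c i) f)" if "bij \<pi>" for \<pi> i
    using pdiff_act[OF bij_is_inj[OF that], of i "\<lambda>_. 1" f] assms that const_term_act[of _ "pdiff (c i) f"]
    by (auto simp: R_A_iff Const_one)
  \<comment> \<open>The gradient at 0 sums to zero by translation invariance and has equal entries
    by symmetry: there is no nonzero linear invariant.\<close>
  have "const_term (pdiff (c 1) f) = - const_term (pdiff (c 2) f) - const_term (pdiff (c 3) f)"
    using S_A_translation_invariant[of f c] assms by (simp add: R_A_iff lookup_minus)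
  moreover have "const_term (pdiff (c j) f) = const_term (pdiff (c i) f)" for j
    using sym[of "transpose i j" i] by simp
  then have "const_term (pdiff (c k) f) = const_term (pdiff (c 1) f)" for k
    by metis
  ultimately have "const_term (pdiff (c 1) f) = - const_term (pdiff (c 1) f) - const_term (pdiff (c 1) f)"
    by metis
  then have "const_term (pdiff (c 1) f) = 0"
    by (simp add: algebra_simps)
  then show ?thesis
    using \<open>\<And>k. const_term (pdiff (c k) f) = const_term (pdiff (c 1) f)\<close> by metis
qed

lemma subspace_augmentation_ideal: "pol.subspace P \<Longrightarrow> pol.subspace (augmentation_ideal P)"
  by (rule pol.subspaceI)
    (auto simp: augmentation_ideal_def pol.subspace_0 pol.subspace_add pol.subspace_scale
      lookup_add const_term_scale)

lemma bracket_span_R_A: "bracket_span R_A = augmentation_ideal R_A"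
proof
  show le: "bracket_span R_A \<subseteq> augmentation_ideal R_A"
  proof (rule bracket_span_subset)
    show "pol.subspace (augmentation_ideal R_A)"
      by (intro subspace_augmentation_ideal subspace_invariants S_A_subspace)
  next
    fix f g assume f: "f \<in> R_A" and g: "g \<in> R_A"
    then have "const_term (poisson f g) = 0"
      by (simp add: poisson_def lookup_sum lookup_minus const_term_mult R_A_const_term_pdiff)
    with f g show "poisson f g \<in> augmentation_ideal R_A"
      by (simp add: augmentation_ideal_def poisson_in_R_A)
  qed
  show "augmentation_ideal R_A \<subseteq> bracket_span R_A"
  proof
    fix f assume "f \<in> augmentation_ideal R_A"
    then have f: "f \<in> R_A" "const_term f = 0" by (auto simp: augmentation_ideal_def)
    define N :: complex where "N = of_nat (card {\<pi> :: 3 \<Rightarrow> 3. bij \<pi>})"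
    have "f \<in> sl2_span" using f(1) S_A_subset_sl2_span by (auto simp: R_A_iff)
    then obtain c where c: "scale N f - Const c \<in> bracket_span R_A"
      using symmetrization_sl2_span symmetrization_R_A[OF f(1)] unfolding N_def by metis
    \<comment> \<open>The inclusion already proved fixes the constant: neither brackets nor
      \<open>f\<close> have a constant term, so \<open>c\<close> is 0.\<close>
    with le have "const_term (scale N f - Const c) = 0"
      by (auto simp: augmentation_ideal_def)
    then have "c = 0" by (simp add: lookup_minus const_term_scale f(2))
    with c have "scale (1 / N) (scale N f) \<in> bracket_span R_A"
      by (intro bracket_span_scale[of "scale N f"]) (simp add: Const_def)
    moreover have "N \<noteq> 0"
      using bij_id by (auto simp: N_def card_eq_0_iff)
    ultimately show "f \<in> bracket_span R_A" by simp
  qed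
qed

lemma ideal_augmentation_ideal:
  assumes "cring (alg P)" "pol.subspace P"
  shows "ideal (augmentation_ideal P) (alg P)"
proof -
  interpret cring "alg P" by (rule assms(1))
  have mult: "f * g \<in> P" if "f \<in> P" "g \<in> P" for f g
    using m_closed[of f g] that by (simp add: alg_def)
  note sub = subspace_augmentation_ideal[OF assms(2)]
  show ?thesis
  proof (rule idealI)
    show "subgroup (augmentation_ideal P) (add_monoid (alg P))"
    proof (rule add.subgroupI)
      show "augmentation_ideal P \<subseteq> carrier (alg P)"
        by (auto simp: augmentation_ideal_def alg_def)
      show "augmentation_ideal P \<noteq> {}"
        using pol.subspace_0[OF sub] by blast
      show "\<ominus>\<^bsub>alg P\<^esub> f \<in> augmentation_ideal P" if "f \<in> augmentation_ideal P" for f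
      proof -
        have "- f \<in> augmentation_ideal P"
          using pol.subspace_neg[OF sub that] .
        moreover have "\<ominus>\<^bsub>alg P\<^esub> f = - f"
          using that calculation by (intro minus_equality) (auto simp: augmentation_ideal_def alg_def)
        ultimately show ?thesis by simp
      qed
      show "f \<oplus>\<^bsub>alg P\<^esub> g \<in> augmentation_ideal P"
        if "f \<in> augmentation_ideal P" "g \<in> augmentation_ideal P" for f g
        using pol.subspace_add[OF sub that] by (simp add: alg_def)
    qed
  qed (auto simp: alg_def augmentation_ideal_def mult const_term_mult
      intro: local.ring_axioms[unfolded alg_def])
qed

theorem mainTheorem8:
  shows "(ideal (bracket_span (invariants S_A W_A2)) (alg (invariants S_A W_A2)) \<and>
          bracket_span (invariants S_A W_A2) = augmentation_ideal (invariants S_A W_A2)) \<and>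
         \<not> ideal (bracket_span (invariants S_B W_B2)) (alg (invariants S_B W_B2)) \<and>
         \<not> ideal (bracket_span (invariants S_A W_G2)) (alg (invariants S_A W_G2))"
  using ideal_augmentation_ideal[OF cring_invariants_SA subspace_invariants[OF S_A_subspace]]
  by (simp add: bracket_span_R_A not_ideal_R_B not_ideal_R_G)

end
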